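(* Let $m\ge1$ and let $A:\mathcal{M}\to\mathcal{N}$ be a nonzero pure contraction (that is, $\|Ah\|<\|h\|$ for all $h\in\mathcal{M}$, $h\neq0$) between separable complex Hilbert spaces. Let $\mathcal{H}=\bigoplus_{n\in\mathbb{Z}}\mathcal{L}_n$, where $\mathcal{L}_n=\mathcal{N}$ for $n\ge1$ and $\mathcal{L}_n=\mathcal{M}$ for $n\le0$, and let $\tilde T_A\in\mathcal{L}(\mathcal{H})$ be defined by $$\tilde T_A|_{\mathcal{L}_n}=\begin{cases}-A\oplus D_A:\mathcal{L}_{-m}\to\mathcal{L}_1\oplus\mathcal{L}_{-m+1},&n=-m,\\ 0,&n=0,\\ I:\mathcal{L}_n\to\mathcal{L}_{n+1},&n\ne0,-m.\end{cases}$$ Then $\tilde T_A$ is a completely non unitary partial isometry and the characteristic function of $\tilde T_A$ coincides with $\Theta(z)=Az^m$. Moreover, the upper triangular representation of $\tilde T_A$ with respect to the decomposition $$\mathcal{H}=\Big(\bigoplus_{n\ge1}\mathcal{L}_n\Big)\oplus\Big(\bigoplus_{n=-m+1}^{0}\mathcal{L}_n\Big)\oplus\Big(\bigoplus_{n\le-m}\mathcal{L}_n\Big)$$ coincides with the $*$-canonical representation of $\tilde T_A$.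
   Context: $D_A=(I-A^*A)^{1/2}$. A contraction $T$ is completely non unitary (c.n.u.) if there is no nonzero $T$-reducing subspace on which $T$ is unitary. Put $D_T=(I-T^*T)^{1/2}$, $D_{T^*}=(I-TT^* )^{1/2}$, $\mathcal{D}_T=\overline{\mathrm{Ran}\,D_T}$, $\mathcal{D}_{T^*}=\overline{\mathrm{Ran}\,D_{T^*}}$. The characteristic function of $T$ is $\Theta_T(z)=[-T+zD_{T^*}(I-zT^* )^{-1}D_T]|_{\mathcal{D}_T}\in\mathcal{L}(\mathcal{D}_T,\mathcal{D}_{T^*})$, $z\in\mathbb{D}$. Operator valued functions $\Theta:\mathbb{D}\to\mathcal{L}(\mathcal{E},\mathcal{E}_* )$ and $\Psi:\mathbb{D}\to\mathcal{L}(\mathcal{F},\mathcal{F}_* )$ coincide if there are unitaries $\tau:\mathcal{E}\to\mathcal{F}$, $\tau_*:\mathcal{E}_*\to\mathcal{F}_*$ with $\tau_*\Theta(z)=\Psi(z)\tau$ for all $z\in\mathbb{D}$. For a c.n.u. contraction $T$ on $\mathcal{H}$ whose characteristic function is a polynomial of degree $d$, the $*$-canonical representation is the block upper triangular representation of $T$ with respect to $\mathcal{H}=\mathcal{H}^{(c)}_{1*}\oplus\mathcal{H}^{(c)}_{0*}\oplus\mathcal{H}^{(c)}_{-1*}$, where $\mathcal{H}^{(c)}_{1*}=\{h:\|T^{k+1}h\|=\|T^kh\|,k\ge0\}$, $\mathcal{H}^{(c)}_{-1*}=\overline{\mathrm{span}}\{T^{*k}h:h\in\mathcal{D}_T,k\ge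 d\}$ and $\mathcal{H}^{(c)}_{0*}=\mathcal{H}\ominus(\mathcal{H}^{(c)}_{1*}\oplus\mathcal{H}^{(c)}_{-1*})$. (Equivalently: among all orthogonal three-term decompositions in which $T$ is block upper triangular with diagonal entries a unilateral shift, a nilpotent of order $d$, and the adjoint of a unilateral shift, it is the unique one with the largest first space and the smallest third space.) *)

theory Defs
  imports "HOL-Analysis.Analysis"
begin

section \<open>Complex Hilbert spaces\<close>

text \<open>
  The distribution only provides real inner product spaces.  A complex inner product space is taken
  to be a real one (which fixes the norm and the topology) with a complex scalar multiplication
  extending the real one, and a sesquilinear form (linear in the first argument) whose real part is
  the given real inner product.  Positivity of \<open>cinner\<close> is inherited from \<^class>\<open>real_inner\<close>.
\<close>

class scaleC =
  fixes scaleC :: "complex \<Rightarrow> 'a \<Rightarrow> 'a"  (infixr "*\<^sub>C" 75)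

class complex_inner = real_inner + scaleC +
  fixes cinner :: "'a \<Rightarrow> 'a \<Rightarrow> complex"
  assumes scaleC_add_right: "c *\<^sub>C (x + y) = c *\<^sub>C x + c *\<^sub>C y"
    and scaleC_add_left: "(c + d) *\<^sub>C x = c *\<^sub>C x + d *\<^sub>C x"
    and scaleC_scaleC: "c *\<^sub>C (d *\<^sub>C x) = (c * d) *\<^sub>C x"
    and scaleR_scaleC: "r *\<^sub>R x = complex_of_real r *\<^sub>C x"
    and cinner_commute: "cinner x y = cnj (cinner y x)"
    and cinner_add_left: "cinner (x + y) z = cinner x z + cinner y z"
    and cinner_scaleC_left: "cinner (c *\<^sub>C x) y = c * cinner x y"
    and inner_Re_cinner: "inner x y = Re (cinner x y)"

class chilbert_space = complex_inner + complete_space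

lemma scaleC_one: "1 *\<^sub>C x = (x :: 'a::complex_inner)"
  using scaleR_scaleC[of 1 x] by simp

global_interpretation complex_vector: vector_space "scaleC :: complex \<Rightarrow> 'a \<Rightarrow> 'a::complex_inner"
  defines csubspace = complex_vector.subspace
    and cspan = complex_vector.span
  by unfold_locales (simp_all add: scaleC_add_right scaleC_add_left scaleC_scaleC scaleC_one)

lemma cinner_add_right: "cinner x (y + z) = cinner x y + cinner x (z :: 'a::complex_inner)"
  by (metis cinner_add_left cinner_commute complex_cnj_add)

lemma cinner_scaleC_right: "cinner x (c *\<^sub>C y) = cnj c * cinner x (y :: 'a::complex_inner)"
  by (metis cinner_scaleC_left cinner_commute complex_cnj_mult)

lemma cinner_self: "cinner x x = complex_of_real ((norm (x :: 'a::complex_inner))\<^sup>2)"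
proof -
  have "Im (cinner x x) = 0"
    using arg_cong[OF cinner_commute[of x x], of Im] by simp
  then show ?thesis
    by (simp add: complex_eq_iff power2_norm_eq_inner inner_Re_cinner)
qed

lemma norm_scaleC: "norm (c *\<^sub>C x) = cmod c * norm (x :: 'a::complex_inner)"
proof -
  have "complex_of_real ((norm (c *\<^sub>C x))\<^sup>2) = complex_of_real ((cmod c * norm x)\<^sup>2)"
    unfolding cinner_self[symmetric] cinner_scaleC_left cinner_scaleC_right
    by (simp add: cinner_self power_mult_distrib complex_norm_square mult.assoc del: of_real_power)
  then have "(norm (c *\<^sub>C x))\<^sup>2 = (cmod c * norm x)\<^sup>2"
    using of_real_eq_iff by blast
  then show ?thesis
    by (rule power2_eq_imp_eq) simp_all
qed

lemma cmod_cinner_le: "cmod (cinner x y) \<le> (norm x)\<^sup>2 + (norm (y :: 'a::complex_inner))\<^sup>2"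
proof -
  have "cmod (cinner x y) \<le> \<bar>Re (cinner x y)\<bar> + \<bar>Im (cinner x y)\<bar>"
    by (rule cmod_le)
  also have "Im (cinner x y) = - Re (cinner (\<i> *\<^sub>C x) y)"
    by (simp add: cinner_scaleC_left)
  also have "\<bar>Re (cinner x y)\<bar> + \<bar>- Re (cinner (\<i> *\<^sub>C x) y)\<bar> \<le> norm x * norm y + norm x * norm y"
    using Cauchy_Schwarz_ineq2[of x y] Cauchy_Schwarz_ineq2[of "\<i> *\<^sub>C x" y]
    by (simp add: norm_scaleC flip: inner_Re_cinner)
  also have "\<dots> \<le> (norm x)\<^sup>2 + (norm y)\<^sup>2"
    using sum_squares_bound[of "norm x" "norm y"] by simp
  finally show ?thesis .
qed

instantiation complex :: complex_inner
begin
definition "scaleC_complex = ((*) :: complex \<Rightarrow> complex \<Rightarrow> complex)"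
definition "cinner_complex x y = x * cnj y" for x y :: complex
instance
  by standard
    (auto simp: scaleC_complex_def cinner_complex_def algebra_simps scaleR_conv_of_real inner_complex_def)
end

instance complex :: chilbert_space ..

instantiation prod :: (complex_inner, complex_inner) complex_inner
begin
definition "c *\<^sub>C x = (c *\<^sub>C fst x, c *\<^sub>C snd x)" for x :: "'a \<times> 'b"
definition "cinner x y = cinner (fst x) (fst y) + cinner (snd x) (snd y)" for x y :: "'a \<times> 'b"
instance
proof
  fix x y :: "'a \<times> 'b"
  show "cinner x y = cnj (cinner y x)"
    using cinner_commute[of "fst x" "fst y"] cinner_commute[of "snd x" "snd y"]
    by (simp add: cinner_prod_def)
qed (auto simp: scaleC_prod_def cinner_prod_def scaleC_add_right scaleC_add_left scaleC_scaleC
    scaleR_scaleC cinner_add_left cinner_scaleC_left inner_prod_def inner_Re_cinner algebra_simps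
    prod_eq_iff)
end

instance prod :: (chilbert_space, chilbert_space) chilbert_space ..


section \<open>Operators\<close>

text \<open>\<open>T \<in> L(E, F)\<close>, where \<open>E\<close> and \<open>F\<close> are (closed) subspaces of the ambient spaces.\<close>

definition bounded_clinear_on ::
  "'a::complex_inner set \<Rightarrow> 'b::complex_inner set \<Rightarrow> ('a \<Rightarrow> 'b) \<Rightarrow> bool" where
  "bounded_clinear_on E F T \<longleftrightarrow>
     (\<forall>x\<in>E. T x \<in> F) \<and>
     (\<forall>x\<in>E. \<forall>y\<in>E. T (x + y) = T x + T y) \<and>
     (\<forall>c. \<forall>x\<in>E. T (c *\<^sub>C x) = c *\<^sub>C T x) \<and>
     (\<exists>K. \<forall>x\<in>E. norm (T x) \<le> K * norm x)"

abbreviation bounded_clinear :: "('a::complex_inner \<Rightarrow> 'b::complex_inner) \<Rightarrow> bool" where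
  "bounded_clinear T \<equiv> bounded_clinear_on UNIV UNIV T"

definition unitary_on ::
  "'a::complex_inner set \<Rightarrow> 'b::complex_inner set \<Rightarrow> ('a \<Rightarrow> 'b) \<Rightarrow> bool" where
  "unitary_on E F U \<longleftrightarrow> bounded_clinear_on E F U \<and> U ` E = F \<and> (\<forall>x\<in>E. norm (U x) = norm x)"

definition cadjoint :: "('a::complex_inner \<Rightarrow> 'b::complex_inner) \<Rightarrow> 'b \<Rightarrow> 'a" where
  "cadjoint T = (THE S. \<forall>x y. cinner (T x) y = cinner x (S y))"

definition positive_op :: "('a::complex_inner \<Rightarrow> 'a) \<Rightarrow> bool" where
  "positive_op P \<longleftrightarrow> bounded_clinear P \<and> (\<forall>x. cinner (P x) x \<in> \<real> \<and> 0 \<le> Re (cinner (P x) x))"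

definition op_sqrt :: "('a::complex_inner \<Rightarrow> 'a) \<Rightarrow> 'a \<Rightarrow> 'a" where
  "op_sqrt P = (THE S. positive_op S \<and> S \<circ> S = P)"

definition contraction_op :: "('a::complex_inner \<Rightarrow> 'b::complex_inner) \<Rightarrow> bool" where
  "contraction_op T \<longleftrightarrow> bounded_clinear T \<and> (\<forall>x. norm (T x) \<le> norm x)"

definition pure_contraction :: "('a::complex_inner \<Rightarrow> 'b::complex_inner) \<Rightarrow> bool" where
  "pure_contraction A \<longleftrightarrow> bounded_clinear A \<and> (\<forall>h. h \<noteq> 0 \<longrightarrow> norm (A h) < norm h)"

definition orth_compl :: "'a::complex_inner set \<Rightarrow> 'a set" where
  "orth_compl S = {x. \<forall>y\<in>S. cinner x y = 0}"

definition partial_isometry :: "('a::complex_inner \<Rightarrow> 'b::complex_inner) \<Rightarrow> bool" where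
  "partial_isometry T \<longleftrightarrow>
     bounded_clinear T \<and> (\<forall>x\<in>orth_compl {y. T y = 0}. norm (T x) = norm x)"

definition closed_csubspace :: "'a::complex_inner set \<Rightarrow> bool" where
  "closed_csubspace S \<longleftrightarrow> csubspace S \<and> closed S"

definition reducing :: "('a::complex_inner \<Rightarrow> 'a) \<Rightarrow> 'a set \<Rightarrow> bool" where
  "reducing T S \<longleftrightarrow> closed_csubspace S \<and> T ` S \<subseteq> S \<and> cadjoint T ` S \<subseteq> S"

definition cnu_contraction :: "('a::complex_inner \<Rightarrow> 'a) \<Rightarrow> bool" where
  "cnu_contraction T \<longleftrightarrow>
     contraction_op T \<and> \<not> (\<exists>S. reducing T S \<and> S \<noteq> {0} \<and> unitary_on S S T)"


section \<open>Defect operators and characteristic functions\<close>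

definition defect_op :: "('a::complex_inner \<Rightarrow> 'b::complex_inner) \<Rightarrow> 'a \<Rightarrow> 'a" where
  "defect_op T = op_sqrt (\<lambda>h. h - cadjoint T (T h))"

definition defect_space :: "('a::complex_inner \<Rightarrow> 'b::complex_inner) \<Rightarrow> 'a set" where
  "defect_space T = closure (range (defect_op T))"

text \<open>
  Operator valued functions on the unit disc, with values in \<open>L(E, F)\<close>, are total functions that are
  only considered on the unit disc and on \<open>E\<close>.
\<close>

definition operator_valued ::
  "'a::complex_inner set \<Rightarrow> 'b::complex_inner set \<Rightarrow> (complex \<Rightarrow> 'a \<Rightarrow> 'b) \<Rightarrow> bool" where
  "operator_valued E F \<Theta> \<longleftrightarrow> (\<forall>z\<in>ball 0 1. bounded_clinear_on E F (\<Theta> z))"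

definition coincide ::
  "'a::complex_inner set \<Rightarrow> 'b::complex_inner set \<Rightarrow> (complex \<Rightarrow> 'a \<Rightarrow> 'b) \<Rightarrow>
   'c::complex_inner set \<Rightarrow> 'd::complex_inner set \<Rightarrow> (complex \<Rightarrow> 'c \<Rightarrow> 'd) \<Rightarrow> bool" where
  "coincide E Es \<Theta> F Fs \<Psi> \<longleftrightarrow>
     operator_valued E Es \<Theta> \<and> operator_valued F Fs \<Psi> \<and>
     (\<exists>\<tau> \<tau>s. unitary_on E F \<tau> \<and> unitary_on Es Fs \<tau>s \<and>
       (\<forall>z\<in>ball 0 1. \<forall>h\<in>E. \<tau>s (\<Theta> z h) = \<Psi> z (\<tau> h)))"

text \<open>To be read as a function with values in \<open>L(defect_space T, defect_space (cadjoint T))\<close>.\<close>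

definition char_fun :: "('a::complex_inner \<Rightarrow> 'a) \<Rightarrow> complex \<Rightarrow> 'a \<Rightarrow> 'a" where
  "char_fun T z h =
     - T h + z *\<^sub>C defect_op (cadjoint T) (inv (\<lambda>x. x - z *\<^sub>C cadjoint T x) (defect_op T h))"

definition op_polynomial ::
  "'a::complex_inner set \<Rightarrow> 'b::complex_inner set \<Rightarrow> (complex \<Rightarrow> 'a \<Rightarrow> 'b) \<Rightarrow> nat \<Rightarrow> bool" where
  "op_polynomial E F \<Theta> d \<longleftrightarrow>
     (\<exists>C. (\<forall>k\<le>d. bounded_clinear_on E F (C k)) \<and> (\<exists>h\<in>E. C d h \<noteq> 0) \<and>
       (\<forall>z\<in>ball 0 1. \<forall>h\<in>E. \<Theta> z h = (\<Sum>k\<le>d. z ^ k *\<^sub>C C k h)))"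


section \<open>Upper triangular and \<open>*\<close>-canonical representations\<close>

definition orth_decomposition ::
  "'a::complex_inner set \<Rightarrow> 'a set \<Rightarrow> 'a set \<Rightarrow> bool" where
  "orth_decomposition X Y Z \<longleftrightarrow>
     closed_csubspace X \<and> closed_csubspace Y \<and> closed_csubspace Z \<and>
     X \<subseteq> orth_compl Y \<and> X \<subseteq> orth_compl Z \<and> Y \<subseteq> orth_compl Z \<and>
     (\<forall>h. \<exists>x\<in>X. \<exists>y\<in>Y. \<exists>z\<in>Z. h = x + y + z)"

text \<open>The block of \<open>T\<close> from \<open>X\<close> to \<open>Y\<close> vanishes iff \<open>T ` X\<close> is orthogonal to \<open>Y\<close>.\<close>

definition upper_triangular_wrt ::
  "('a::complex_inner \<Rightarrow> 'a) \<Rightarrow> 'a set \<Rightarrow> 'a set \<Rightarrow> 'a set \<Rightarrow> bool" where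
  "upper_triangular_wrt T X Y Z \<longleftrightarrow>
     orth_decomposition X Y Z \<and>
     T ` X \<subseteq> orth_compl Y \<and> T ` X \<subseteq> orth_compl Z \<and> T ` Y \<subseteq> orth_compl Z"

definition star_canonical_1 :: "('a::complex_inner \<Rightarrow> 'a) \<Rightarrow> 'a set" where
  "star_canonical_1 T = {h. \<forall>k. norm ((T ^^ (k + 1)) h) = norm ((T ^^ k) h)}"

definition star_canonical_m1 :: "nat \<Rightarrow> ('a::complex_inner \<Rightarrow> 'a) \<Rightarrow> 'a set" where
  "star_canonical_m1 d T =
     closure (cspan {(cadjoint T ^^ k) h | k h. h \<in> defect_space T \<and> d \<le> k})"

definition star_canonical_0 :: "nat \<Rightarrow> ('a::complex_inner \<Rightarrow> 'a) \<Rightarrow> 'a set" where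
  "star_canonical_0 d T = orth_compl (star_canonical_1 T \<union> star_canonical_m1 d T)"

text \<open>
  The representation of \<open>T\<close> with respect to a given decomposition is determined by the three spaces,
  so it is the \<open>*\<close>-canonical one iff it is upper triangular and the spaces are the canonical ones.
\<close>

definition star_canonical_representation ::
  "('a::complex_inner \<Rightarrow> 'a) \<Rightarrow> 'a set \<Rightarrow> 'a set \<Rightarrow> 'a set \<Rightarrow> bool" where
  "star_canonical_representation T X Y Z \<longleftrightarrow>
     cnu_contraction T \<and> upper_triangular_wrt T X Y Z \<and>
     (\<exists>d. op_polynomial (defect_space T) (defect_space (cadjoint T)) (char_fun T) d \<and>
       X = star_canonical_1 T \<and> Y = star_canonical_0 d T \<and> Z = star_canonical_m1 d T)"


section \<open>The two-sided direct sum\<close>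

text \<open>
  The summand with index \<open>n\<close> is \<open>'n\<close> for \<open>n \<ge> 1\<close> and \<open>'m\<close> for \<open>n \<le> 0\<close>.  To have a uniform type of
  entries, both are embedded as coordinate subspaces into \<open>'m \<times> 'n\<close>.
\<close>

definition summand :: "int \<Rightarrow> ('m::complex_inner \<times> 'n::complex_inner) set" where
  "summand n = (if n \<ge> 1 then {0} \<times> UNIV else UNIV \<times> {0})"

typedef (overloaded) ('m::complex_inner, 'n::complex_inner) bisum =
  "{h :: int \<Rightarrow> 'm \<times> 'n. (\<forall>n. h n \<in> summand n) \<and> (\<lambda>n. (norm (h n))\<^sup>2) summable_on UNIV}"
  morphisms entry Abs_bisum
  by (rule exI[of _ "\<lambda>_. 0"]) (simp add: summand_def zero_prod_def)

lemma entry_summand: "entry h n \<in> summand n"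
  and entry_summable: "(\<lambda>n. (norm (entry h n))\<^sup>2) summable_on UNIV"
  using entry[of h] by auto

lemma entry_Abs:
  "(\<And>n. h n \<in> summand n) \<Longrightarrow> (\<lambda>n. (norm (h n))\<^sup>2) summable_on UNIV \<Longrightarrow> entry (Abs_bisum h) = h"
  by (simp add: Abs_bisum_inverse)

lemma bisum_eqI: "(\<And>n. entry x n = entry y n) \<Longrightarrow> x = y"
  using entry_inject[of x y] by auto

lemma summand_0: "0 \<in> summand n"
  and summand_add: "x \<in> summand n \<Longrightarrow> y \<in> summand n \<Longrightarrow> x + y \<in> summand n"
  and summand_diff: "x \<in> summand n \<Longrightarrow> y \<in> summand n \<Longrightarrow> x - y \<in> summand n"
  and summand_uminus: "x \<in> summand n \<Longrightarrow> - x \<in> summand n"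
  and summand_scaleC: "x \<in> summand n \<Longrightarrow> c *\<^sub>C x \<in> summand n"
  by (auto simp: summand_def scaleC_prod_def zero_prod_def split: if_splits)

lemma summand_scaleR: "x \<in> summand n \<Longrightarrow> r *\<^sub>R x \<in> summand n"
  by (simp add: scaleR_scaleC summand_scaleC)

lemma closed_summand: "closed (summand n)"
  by (auto simp: summand_def intro!: closed_Times)

lemma summable_sq_add:
  fixes x y :: "'i \<Rightarrow> 'a::real_inner"
  assumes "(\<lambda>n. (norm (x n))\<^sup>2) summable_on S" "(\<lambda>n. (norm (y n))\<^sup>2) summable_on S"
  shows "(\<lambda>n. (norm (x n + y n))\<^sup>2) summable_on S"
proof (rule summable_on_comparison_test)
  show "(\<lambda>n. 2 * (norm (x n))\<^sup>2 + 2 * (norm (y n))\<^sup>2) summable_on S"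
    by (intro summable_on_add summable_on_cmult_right assms)
  have "(norm (a + b))\<^sup>2 \<le> 2 * (norm a)\<^sup>2 + 2 * (norm b)\<^sup>2" for a b :: 'a
    using zero_le_power2[of "norm (a - b)"]
    by (simp add: power2_norm_eq_inner inner_simps inner_commute)
  then show "(norm (x n + y n))\<^sup>2 \<le> 2 * (norm (x n))\<^sup>2 + 2 * (norm (y n))\<^sup>2" for n .
qed simp

lemma summable_sq_scaleC:
  fixes x :: "'i \<Rightarrow> 'a::complex_inner"
  assumes "(\<lambda>n. (norm (x n))\<^sup>2) summable_on S"
  shows "(\<lambda>n. (norm (c *\<^sub>C x n))\<^sup>2) summable_on S"
  by (simp add: norm_scaleC power_mult_distrib summable_on_cmult_right assms)

lemma summable_cinner:
  fixes x y :: "'i \<Rightarrow> 'a::complex_inner"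
  assumes "(\<lambda>n. (norm (x n))\<^sup>2) summable_on S" "(\<lambda>n. (norm (y n))\<^sup>2) summable_on S"
  shows "(\<lambda>n. cinner (x n) (y n)) summable_on S"
proof -
  have "(\<lambda>n. (norm (x n))\<^sup>2 + (norm (y n))\<^sup>2) summable_on S"
    by (intro summable_on_add assms)
  then have "(\<lambda>n. cmod (cinner (x n) (y n))) summable_on S"
    by (rule summable_on_comparison_test) (simp_all add: cmod_cinner_le)
  then show ?thesis
    by (rule abs_summable_summable)
qed

instantiation bisum :: (complex_inner, complex_inner) complex_inner
begin

definition "0 = Abs_bisum (\<lambda>_. 0)"
definition "x + y = Abs_bisum (\<lambda>n. entry x n + entry y n)"
definition "- x = Abs_bisum (\<lambda>n. - entry x n)"
definition "x - y = x + (- y :: ('a, 'b) bisum)"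
definition "c *\<^sub>C x = Abs_bisum (\<lambda>n. c *\<^sub>C entry x n)"
definition "r *\<^sub>R x = complex_of_real r *\<^sub>C (x :: ('a, 'b) bisum)"
definition "cinner x y = (\<Sum>\<^sub>\<infinity>n. cinner (entry x n) (entry y n))"
definition "inner x y = Re (cinner x (y :: ('a, 'b) bisum))"
definition "norm x = sqrt (inner x (x :: ('a, 'b) bisum))"
definition "dist x y = norm (x - y :: ('a, 'b) bisum)"
definition "sgn x = scaleR (inverse (norm x)) (x :: ('a, 'b) bisum)"
definition "(uniformity :: (('a, 'b) bisum \<times> ('a, 'b) bisum) filter) =
  (INF e\<in>{0 <..}. principal {(x, y). dist x y < e})"
definition "open U \<longleftrightarrow> (\<forall>x\<in>U. \<forall>\<^sub>F (x', y) in uniformity. x' = x \<longrightarrow> y \<in> U)"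
  for U :: "('a, 'b) bisum set"

lemma entry_zero: "entry (0 :: ('a, 'b) bisum) n = 0"
  by (simp add: zero_bisum_def entry_Abs summand_0)

lemma entry_add: "entry (x + y :: ('a, 'b) bisum) n = entry x n + entry y n"
  by (simp add: plus_bisum_def entry_Abs summand_add entry_summand summable_sq_add entry_summable)

lemma entry_uminus: "entry (- x :: ('a, 'b) bisum) n = - entry x n"
  by (simp add: uminus_bisum_def entry_Abs summand_uminus entry_summand entry_summable)

lemma entry_minus: "entry (x - y :: ('a, 'b) bisum) n = entry x n - entry y n"
  by (simp add: minus_bisum_def entry_add entry_uminus)

lemma entry_scaleC: "entry (c *\<^sub>C x :: ('a, 'b) bisum) n = c *\<^sub>C entry x n"
  by (simp add: scaleC_bisum_def entry_Abs summand_scaleC entry_summand summable_sq_scaleC entry_summable)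

lemma entry_scaleR: "entry (r *\<^sub>R x :: ('a, 'b) bisum) n = r *\<^sub>R entry x n"
  by (simp add: scaleR_bisum_def entry_scaleC scaleR_scaleC)

lemma inner_bisum_self: "inner x (x :: ('a, 'b) bisum) = (\<Sum>\<^sub>\<infinity>n. (norm (entry x n))\<^sup>2)"
proof -
  have "cinner x x = (\<Sum>\<^sub>\<infinity>n. complex_of_real ((norm (entry x n))\<^sup>2))"
    by (simp add: cinner_bisum_def cinner_self)
  also have "\<dots> = complex_of_real (\<Sum>\<^sub>\<infinity>n. (norm (entry x n))\<^sup>2)"
    by (rule infsumI) (simp only: has_sum_of_real_iff has_sum_infsum entry_summable)
  finally show ?thesis
    by (simp add: inner_bisum_def)
qed

lemma cinner_bisum_summable:
  "(\<lambda>n. cinner (entry x n) (entry (y :: ('a, 'b) bisum) n)) summable_on UNIV"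
  by (intro summable_cinner entry_summable)

instance
proof
  fix x y z :: "('a, 'b) bisum" and c d :: complex and r s :: real
  show "x + y + z = x + (y + z)" "x + y = y + x" "0 + x = x" "- x + x = 0"
    "r *\<^sub>R (x + y) = r *\<^sub>R x + r *\<^sub>R y" "(r + s) *\<^sub>R x = r *\<^sub>R x + s *\<^sub>R x"
    "r *\<^sub>R s *\<^sub>R x = (r * s) *\<^sub>R x" "1 *\<^sub>R x = x"
    by (auto intro!: bisum_eqI simp: entry_add entry_zero entry_uminus entry_scaleR algebra_simps)
  show "c *\<^sub>C (x + y) = c *\<^sub>C x + c *\<^sub>C y" "(c + d) *\<^sub>C x = c *\<^sub>C x + d *\<^sub>C x"
    "c *\<^sub>C (d *\<^sub>C x) = (c * d) *\<^sub>C x"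
    by (auto intro!: bisum_eqI simp: entry_add entry_scaleC scaleC_add_right scaleC_add_left scaleC_scaleC)
  show commute: "cinner x y = cnj (cinner y x)" for x y :: "('a, 'b) bisum"
    unfolding cinner_bisum_def infsum_cnj[symmetric] by (metis cinner_commute)
  show add: "cinner (x + y) z = cinner x z + cinner y z"
    unfolding cinner_bisum_def entry_add cinner_add_left
    by (intro infsum_add cinner_bisum_summable)
  show scale: "cinner (c *\<^sub>C x) y = c * cinner x y" for c
    unfolding cinner_bisum_def entry_scaleC cinner_scaleC_left
    by (intro infsum_cmult_right cinner_bisum_summable)
  show "inner x y = inner y x"
    unfolding inner_bisum_def by (subst commute) simp
  show "inner (x + y) z = inner x z + inner y z"
    by (simp add: inner_bisum_def add)
  show "inner (r *\<^sub>R x) y = r * inner x y"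
    by (simp add: inner_bisum_def scaleR_bisum_def scale)
  show "0 \<le> inner x x"
    by (simp add: inner_bisum_self infsum_nonneg)
  show "inner x x = 0 \<longleftrightarrow> x = 0"
  proof
    assume "inner x x = 0"
    then have "(norm (entry x n))\<^sup>2 = 0" for n
      by (intro nonneg_infsum_le_0D[where A = UNIV and f = "\<lambda>n. (norm (entry x n))\<^sup>2"])
        (auto simp: inner_bisum_self entry_summable)
    then show "x = 0"
      by (auto intro!: bisum_eqI simp: entry_zero)
  qed (simp add: inner_bisum_self entry_zero)
qed (simp_all add: minus_bisum_def scaleR_bisum_def inner_bisum_def norm_bisum_def dist_bisum_def
    sgn_bisum_def uniformity_bisum_def open_bisum_def)

end

lemma norm_bisum_sq: "(norm x)\<^sup>2 = (\<Sum>\<^sub>\<infinity>n. (norm (entry x n))\<^sup>2)"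
  by (simp add: power2_norm_eq_inner inner_bisum_self)

lemma sum_norm_entry_le: "finite F \<Longrightarrow> (\<Sum>n\<in>F. (norm (entry x n))\<^sup>2) \<le> (norm x)\<^sup>2"
  unfolding norm_bisum_sq by (rule finite_sum_le_infsum) (auto simp: entry_summable)

lemma norm_entry_le: "norm (entry x n) \<le> norm x"
  by (rule power2_le_imp_le) (use sum_norm_entry_le[of "{n}" x] in auto)

instance bisum :: (chilbert_space, chilbert_space) chilbert_space
proof
  fix X :: "nat \<Rightarrow> ('a, 'b) bisum"
  assume X: "Cauchy X"
  have "Cauchy (\<lambda>k. entry (X k) n)" for n
  proof (rule metric_CauchyI)
    fix e :: real assume "e > 0"
    then obtain N where N: "\<And>k l. k \<ge> N \<Longrightarrow> l \<ge> N \<Longrightarrow> dist (X k) (X l) < e"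
      using metric_CauchyD[OF X] by blast
    have "dist (entry (X k) n) (entry (X l) n) < e" if "k \<ge> N" "l \<ge> N" for k l
      using N[OF that] norm_entry_le[of "X k - X l" n] by (simp add: dist_norm entry_minus)
    then show "\<exists>N. \<forall>k\<ge>N. \<forall>l\<ge>N. dist (entry (X k) n) (entry (X l) n) < e"
      by blast
  qed
  then have "\<exists>g. (\<lambda>k. entry (X k) n) \<longlonglongrightarrow> g" for n
    by (simp add: Cauchy_convergent_iff convergent_def)
  then obtain g where g: "\<And>n. (\<lambda>k. entry (X k) n) \<longlonglongrightarrow> g n"
    by metis
  have g_summand: "g n \<in> summand n" for n
    using closed_sequentially[OF closed_summand _ g] entry_summand by blast
  have tail: "\<exists>N. \<forall>k\<ge>N. \<forall>F. finite F \<longrightarrow> (\<Sum>n\<in>F. (norm (entry (X k) n - g n))\<^sup>2) \<le> e\<^sup>2"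
    if "e > 0" for e :: real
  proof -
    obtain N where N: "\<And>k l. k \<ge> N \<Longrightarrow> l \<ge> N \<Longrightarrow> dist (X k) (X l) < e"
      using metric_CauchyD[OF X \<open>e > 0\<close>] by blast
    have "(\<Sum>n\<in>F. (norm (entry (X k) n - g n))\<^sup>2) \<le> e\<^sup>2" if "k \<ge> N" "finite F" for k F
    proof (rule LIMSEQ_le_const2)
      show "(\<lambda>l. \<Sum>n\<in>F. (norm (entry (X k) n - entry (X l) n))\<^sup>2)
              \<longlonglongrightarrow> (\<Sum>n\<in>F. (norm (entry (X k) n - g n))\<^sup>2)"
        by (intro tendsto_intros g)
      have "(\<Sum>n\<in>F. (norm (entry (X k) n - entry (X l) n))\<^sup>2) \<le> e\<^sup>2" if "l \<ge> N" for l
      proof -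
        have "(\<Sum>n\<in>F. (norm (entry (X k) n - entry (X l) n))\<^sup>2) \<le> (norm (X k - X l))\<^sup>2"
          using sum_norm_entry_le[OF \<open>finite F\<close>, of "X k - X l"] by (simp add: entry_minus)
        also have "\<dots> \<le> e\<^sup>2"
          using N[OF \<open>k \<ge> N\<close> \<open>l \<ge> N\<close>] by (intro power_mono) (auto simp: dist_norm)
        finally show ?thesis .
      qed
      then show "\<exists>N. \<forall>l\<ge>N. (\<Sum>n\<in>F. (norm (entry (X k) n - entry (X l) n))\<^sup>2) \<le> e\<^sup>2"
        by blast
    qed
    then show ?thesis by blast
  qed
  have diff_summable: "(\<lambda>n. (norm (entry (X k) n - g n))\<^sup>2) summable_on UNIV"
    if "\<forall>F. finite F \<longrightarrow> (\<Sum>n\<in>F. (norm (entry (X k) n - g n))\<^sup>2) \<le> C" for k C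
    by (rule nonneg_bdd_above_summable_on) (use that in \<open>auto simp: bdd_above_def\<close>)
  obtain N where "\<forall>F. finite F \<longrightarrow> (\<Sum>n\<in>F. (norm (entry (X N) n - g n))\<^sup>2) \<le> 1\<^sup>2"
    using tail[of 1] by auto
  then have "(\<lambda>n. (norm (- (entry (X N) n - g n)))\<^sup>2) summable_on UNIV"
    using diff_summable[of N "1\<^sup>2"] by (simp add: norm_minus_commute)
  from summable_sq_add[OF entry_summable[of "X N"] this]
  have "(\<lambda>n. (norm (g n))\<^sup>2) summable_on UNIV"
    by simp
  then have entry_g: "entry (Abs_bisum g) = g"
    by (intro entry_Abs g_summand)
  have "X \<longlonglongrightarrow> Abs_bisum g"
  proof (rule LIMSEQ_I)
    fix e :: real assume "e > 0"
    then obtain N where N: "\<And>k F. k \<ge> N \<Longrightarrow> finite F \<Longrightarrow>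
        (\<Sum>n\<in>F. (norm (entry (X k) n - g n))\<^sup>2) \<le> (e / 2)\<^sup>2"
      using tail[of "e / 2"] by auto
    have "norm (X k - Abs_bisum g) < e" if "k \<ge> N" for k
    proof -
      have "(norm (X k - Abs_bisum g))\<^sup>2 = (\<Sum>\<^sub>\<infinity>n. (norm (entry (X k) n - g n))\<^sup>2)"
        by (simp add: norm_bisum_sq entry_minus entry_g)
      also have "\<dots> \<le> (e / 2)\<^sup>2"
        using N[OF that] by (intro infsum_le_finite_sums diff_summable[of k "(e / 2)\<^sup>2"]) auto
      finally have "norm (X k - Abs_bisum g) \<le> e / 2"
        by (rule power2_le_imp_le) (use \<open>e > 0\<close> in simp)
      then show ?thesis
        using \<open>e > 0\<close> by linarith
    qed
    then show "\<exists>N. \<forall>k\<ge>N. norm (X k - Abs_bisum g) < e"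
      by blast
  qed
  then show "convergent X"
    by (auto simp: convergent_def)
qed

text \<open>The subspace \<open>\<Oplus>n\<in>I. L\<^sub>n\<close> of the two-sided direct sum.\<close>

definition subsum :: "int set \<Rightarrow> ('m::complex_inner, 'n::complex_inner) bisum set" where
  "subsum I = {h. \<forall>n. n \<notin> I \<longrightarrow> entry h n = 0}"

definition incl :: "int \<Rightarrow> 'm \<times> 'n \<Rightarrow> ('m::complex_inner, 'n::complex_inner) bisum" where
  "incl n x = Abs_bisum (\<lambda>k. if k = n then x else 0)"


section \<open>The model operator\<close>

text \<open>
  The operator is given by its entries; the lemmas after the definition recover the description by
  its restrictions to the summands.
\<close>

definition model_entries ::
  "nat \<Rightarrow> ('m::complex_inner \<Rightarrow> 'n::complex_inner) \<Rightarrow> ('m, 'n) bisum \<Rightarrow> int \<Rightarrow> 'm \<times> 'n" where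
  "model_entries m A h n =
     (if n = 1 then (0, - A (fst (entry h (- int m))))
      else if n = - int m + 1 then (defect_op A (fst (entry h (- int m))), 0)
      else entry h (n - 1))"

definition model_op ::
  "nat \<Rightarrow> ('m::complex_inner \<Rightarrow> 'n::complex_inner) \<Rightarrow> ('m, 'n) bisum \<Rightarrow> ('m, 'n) bisum" where
  "model_op m A h = Abs_bisum (model_entries m A h)"

lemma summable_on_finite_change:
  fixes f g :: "'i \<Rightarrow> real"
  assumes "g summable_on UNIV" "finite F" "\<And>n. n \<notin> F \<Longrightarrow> f n = g n"
  shows "f summable_on UNIV"
proof -
  have "f summable_on (UNIV - F) \<longleftrightarrow> g summable_on (UNIV - F)"
    by (rule summable_on_cong) (use assms in auto)
  moreover have "g summable_on (UNIV - F)"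
    using assms(1) by (rule summable_on_subset_banach) simp
  ultimately have "f summable_on ((UNIV - F) \<union> F)"
    by (intro summable_on_union) (use assms in auto)
  then show ?thesis by simp
qed

lemma entry_model_op: "entry (model_op m A h) = model_entries m A h"
  unfolding model_op_def
proof (rule entry_Abs)
  show "model_entries m A h n \<in> summand n" for n
    using entry_summand[of h "n - 1"] by (auto simp: model_entries_def summand_def split: if_splits)
  have "(\<lambda>n. (norm (entry h (n - 1)))\<^sup>2) summable_on UNIV"
    using entry_summable[of h]
      summable_on_reindex_bij_betw[of "\<lambda>n :: int. n - 1" UNIV UNIV "\<lambda>n. (norm (entry h n))\<^sup>2"]
      bij_betw_byWitness[of UNIV "\<lambda>n. n + 1" "\<lambda>n :: int. n - 1" UNIV]
    by simp
  then show "(\<lambda>n. (norm (model_entries m A h n))\<^sup>2) summable_on UNIV"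
    by (rule summable_on_finite_change[where F = "{1, - int m + 1}"])
      (auto simp: model_entries_def)
qed

lemma entry_incl: "x \<in> summand n \<Longrightarrow> entry (incl n x) k = (if k = n then x else 0)"
  unfolding incl_def
proof (subst entry_Abs)
  show "(\<lambda>k. (norm (if k = n then x else 0))\<^sup>2) summable_on UNIV"
    by (rule summable_on_finite_change[of "\<lambda>_. 0" "{n}"]) auto
qed (auto simp: summand_0)

lemma
  assumes "m \<ge> 1"
    and A: "bounded_clinear A" and D: "bounded_clinear (defect_op A)"
  shows model_op_incl_m:
      "model_op m A (incl (- int m) (x, 0)) = incl 1 (0, - A x) + incl (- int m + 1) (defect_op A x, 0)"
    and model_op_incl_0: "model_op m A (incl 0 (x, 0)) = 0"
    and model_op_incl:
      "n \<noteq> 0 \<Longrightarrow> n \<noteq> - int m \<Longrightarrow> y \<in> summand n \<Longrightarrow> model_op m A (incl n y) = incl (n + 1) y"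
proof -
  have zero: "A 0 = 0" "defect_op A 0 = 0"
    using A D unfolding bounded_clinear_on_def by (metis UNIV_I add_cancel_right_right)+
  show "model_op m A (incl (- int m) (x, 0)) =
      incl 1 (0, - A x) + incl (- int m + 1) (defect_op A x, 0)"
    using \<open>m \<ge> 1\<close>
    by (intro bisum_eqI)
      (simp add: entry_model_op model_entries_def entry_incl entry_add summand_def)
  show "model_op m A (incl 0 (x, 0)) = 0"
    using \<open>m \<ge> 1\<close> zero
    by (intro bisum_eqI)
      (simp add: entry_model_op model_entries_def entry_incl entry_zero summand_def zero_prod_def)
  assume n: "n \<noteq> 0" "n \<noteq> - int m" "y \<in> summand n"
  then have "y \<in> summand (n + 1)"
    by (auto simp: summand_def)
  then show "model_op m A (incl n y) = incl (n + 1) y"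
    using n \<open>m \<ge> 1\<close> zero
    by (intro bisum_eqI)
      (auto simp: entry_model_op model_entries_def entry_incl zero_prod_def)
qed

end

theory Submission
  imports Defs
begin

text \<open>
  Why the theorem holds.  The column \<open>-A \<oplus> D\<^sub>A : L\<^bsub>-m\<^esub> \<rightarrow> L\<^sub>1 \<oplus> L\<^bsub>-m+1\<^esub>\<close> is isometric, because
  \<open>A\<^sup>* A + D\<^sub>A\<^sup>2 = I\<close>.  So the model operator \<open>T\<close> is a shift by one, which annihilates \<open>L\<^sub>0\<close> and is isometric
  on its complement (\<open>T_norm\<close>).  It is a partial isometry, and its defect operators are the orthogonal
  projections onto \<open>ker T = L\<^sub>0\<close> and onto \<open>ker T\<^sup>*\<close>.

  The second kernel lies in \<open>L\<^sub>1 \<oplus> L\<^bsub>-m+1\<^esub>\<close> and is the range of the isometry \<open>W = D\<^bsub>A*\<^esub> \<oplus> A\<^sup>*\<close> defined on \<open>N\<close>: the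
  two columns form the unitary Julia operator of \<open>A\<close>.  The adjoint of \<open>T\<close> carries a vector \<open>x\<close> of \<open>L\<^sub>0\<close>
  backwards to \<open>L\<^bsub>-m+1\<^esub>\<close> in \<open>m - 1\<close> steps, and no other of its backward iterates has a component in
  \<open>L\<^sub>1 \<oplus> L\<^bsub>-m+1\<^esub>\<close>.  Hence the only surviving term of the characteristic function at \<open>x\<close> is \<open>z\<^sup>m W A x\<close>
  (\<open>char_fun_T\<close>), and the inverse of \<open>W\<close> turns it into \<open>z\<^sup>m A x\<close> (\<open>char_fun_coincides\<close>).

  Purity of \<open>A\<close> means that \<open>D\<^sub>A\<close> is injective.  A vector whose iterates never lose norm has no iterate with
  a component in \<open>L\<^sub>0\<close>, and as the only factor met on the way from \<open>L\<^bsub>-j\<^esub>\<close> to \<open>L\<^sub>0\<close> is \<open>D\<^sub>A\<close>, it lives on the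
  indices \<open>n \<ge> 1\<close> (\<open>star_canonical_1_T\<close>).  There \<open>T\<close> is a unilateral shift, which has no unitary part, so
  \<open>T\<close> is completely non unitary (\<open>T_cnu\<close>).  Being self-adjoint and injective, \<open>D\<^sub>A\<close> has dense range, so the
  vectors \<open>T\<^sup>*\<^sup>k x\<close> with \<open>x\<close> in \<open>L\<^sub>0\<close> and \<open>k \<ge> m\<close>, which are the \<open>D\<^sub>A x\<close> placed in \<open>L\<^bsub>-k\<^esub>\<close>, span the summands with
  index \<open>n \<le> -m\<close> (\<open>star_canonical_m1_T\<close>).  The middle space is what remains.

  The operator theory behind this is developed first: adjoints and projections from a Riesz theorem, and
  the positive square root of \<open>I - T\<^sup>* T\<close> as the power series of \<open>\<surd>(1 - t)\<close>.  The series makes the intertwining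
  relation \<open>A D\<^sub>A = D\<^bsub>A*\<^esub> A\<close> evident (\<open>defect_op_intertwine\<close>), on which the computation with \<open>W\<close> depends.
\<close>

section \<open>Complex inner products\<close>

subclass (in chilbert_space) banach ..

lemma cinner_diff_left: "cinner (x - y) z = cinner x z - cinner y (z :: 'a::complex_inner)"
  using cinner_add_left[of "x - y" y z] by simp

lemma cinner_diff_right: "cinner x (y - z) = cinner x y - cinner x (z :: 'a::complex_inner)"
  using cinner_add_right[of x "y - z" z] by simp

lemma cinner_zero_left [simp]: "cinner 0 (x :: 'a::complex_inner) = 0"
  using cinner_diff_left[of 0 0 x] by simp

lemma cinner_zero_right [simp]: "cinner (x :: 'a::complex_inner) 0 = 0"
  using cinner_diff_right[of x 0 0] by simp

lemma cinner_minus_left: "cinner (- x) y = - cinner x (y :: 'a::complex_inner)"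
  using cinner_diff_left[of 0 x y] by simp

lemma cinner_eq_zero_iff: "cinner x x = 0 \<longleftrightarrow> x = (0 :: 'a::complex_inner)"
  by (simp add: cinner_self)

lemma cinner_nondegenerate:
  assumes "\<And>x. cinner x y = cinner x (z :: 'a::complex_inner)"
  shows "y = z"
proof -
  have "cinner (y - z) (y - z) = 0"
    by (simp add: assms cinner_diff_right)
  then show ?thesis
    by (simp add: cinner_eq_zero_iff)
qed

lemma cinner_eq_zero_if_inner:
  assumes "inner x y = 0" "inner (\<i> *\<^sub>C x) y = 0"
  shows "cinner x (y :: 'a::complex_inner) = 0"
  using assms by (simp add: inner_Re_cinner cinner_scaleC_left complex_eq_iff)

section \<open>Riesz representation and orthogonal projection\<close>

text \<open>
  The first variation argument: the form in which minimality (in the Riesz theorem) and positivity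
  (for the kernel of a positive operator) are exploited.
\<close>

lemma quadratic_nonneg_imp_linear_coeff_zero:
  fixes b c :: real
  assumes "\<And>t. 0 \<le> 2 * t * b + t\<^sup>2 * c"
  shows "b = 0"
proof (cases "c = 0")
  case True
  then show ?thesis
    using assms[of "- b"] by (simp add: mult_le_0_iff) (smt (verit) mult_neg_neg mult_pos_pos)
next
  case False
  have "0 \<le> c"
    using assms[of 1] assms[of "- 1"] by simp
  with False have "c > 0"
    by simp
  have "0 \<le> 2 * (- b / c) * b + (- b / c)\<^sup>2 * c"
    by (rule assms)
  also have "\<dots> = - (b\<^sup>2 / c)"
    using False by (simp add: power2_eq_square field_simps)
  finally have "b\<^sup>2 / c \<le> 0"
    by simp
  then show ?thesis
    using \<open>c > 0\<close> by (simp add: divide_le_0_iff)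
qed

text \<open>
  The representing vector is the minimiser over \<open>K\<close> of \<open>\<phi> x = \<parallel>x\<parallel>\<^sup>2 - 2 f x\<close>.  The parallelogram law
  bounds \<open>\<parallel>x - y\<parallel>\<^sup>2\<close> by the excess of \<open>\<phi>\<close> at \<open>x\<close> and \<open>y\<close> over its infimum, so a minimising sequence is
  Cauchy, and the vanishing of the first variation at the minimum is the representation.  A
  relative version, on a closed subspace, is stated because it contains both the existence of
  adjoints (\<open>K\<close> is the whole space) and orthogonal projection (\<open>f\<close> is the inner product with \<open>h\<close>).
\<close>

lemma riesz_on_closed_subspace:
  fixes K :: "'a::{real_inner, complete_space} set" and f :: "'a \<Rightarrow> real"
  assumes K: "subspace K" "closed K" and f: "bounded_linear f"
  obtains x where "x \<in> K" "\<And>y. y \<in> K \<Longrightarrow> inner x y = f y"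
proof -
  interpret f: bounded_linear f by (rule f)
  define \<phi> where "\<phi> x = inner x x - 2 * f x" for x
  define I where "I = Inf (\<phi> ` K)"
  obtain C where C: "\<And>x. norm (f x) \<le> norm x * C"
    using f.bounded by blast
  have bdd: "bdd_below (\<phi> ` K)"
  proof (rule bdd_belowI2)
    fix x
    have "f x \<le> norm x * C"
      using C[of x] abs_le_D1 by (simp only: real_norm_def)
    moreover have "0 \<le> (norm x)\<^sup>2 + C\<^sup>2 - 2 * (norm x * C)"
      using zero_le_power2[of "norm x - C"] by (simp add: power2_diff)
    moreover have "\<phi> x = (norm x)\<^sup>2 - 2 * f x"
      by (simp add: \<phi>_def power2_norm_eq_inner)
    ultimately show "- (C\<^sup>2) \<le> \<phi> x"
      by linarith
  qed
  have I_le: "I \<le> \<phi> x" if "x \<in> K" for x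
    unfolding I_def using that bdd by (auto intro: cInf_lower)
  have "\<exists>x\<in>K. \<phi> x < I + inverse (real (Suc n))" for n
  proof -
    have "\<phi> ` K \<noteq> {}"
      using K(1) subspace_0 by blast
    moreover have "Inf (\<phi> ` K) < I + inverse (real (Suc n))"
      by (simp add: I_def)
    ultimately have "\<exists>y\<in>\<phi> ` K. y < I + inverse (real (Suc n))"
      by (rule cInf_lessD)
    then show ?thesis
      by (rule bex_imageD)
  qed
  then have "\<forall>n. \<exists>x. x \<in> K \<and> \<phi> x < I + inverse (real (Suc n))"
    by (simp only: Bex_def) simp
  from choice[OF this] obtain X
    where X: "\<And>n. X n \<in> K" "\<And>n. \<phi> (X n) < I + inverse (real (Suc n))"
    by blast
  have close: "(dist (X m) (X n))\<^sup>2 \<le> 2 * (inverse (real (Suc m)) + inverse (real (Suc n)))" for m n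
  proof -
    let ?x = "X m" and ?y = "X n"
    have "(1/2) *\<^sub>R (?x + ?y) \<in> K"
      using K(1) X by (intro subspace_scale subspace_add) auto
    then have "I \<le> \<phi> ((1/2) *\<^sub>R (?x + ?y))"
      by (rule I_le)
    moreover have "(dist ?x ?y)\<^sup>2 = 2 * \<phi> ?x + 2 * \<phi> ?y - 4 * \<phi> ((1/2) *\<^sub>R (?x + ?y))"
      unfolding \<phi>_def dist_norm power2_norm_eq_inner
      by (simp add: inner_simps f.add f.scaleR inner_commute algebra_simps)
    moreover have "d \<le> 2 * (u + v)"
      if "I \<le> p" "d = 2 * a + 2 * b - 4 * p" "a < I + u" "b < I + v" for a b d p u v
      using that by argo
    ultimately show ?thesis
      using X(2)[of m] X(2)[of n] by blast
  qed
  have "Cauchy X"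
  proof (rule metric_CauchyI)
    fix e :: real
    assume "e > 0"
    obtain N where N: "inverse (real (Suc N)) < e\<^sup>2 / 4"
      using reals_Archimedean[of "e\<^sup>2 / 4"] \<open>e > 0\<close> by auto
    have "dist (X m) (X n) < e" if "m \<ge> N" "n \<ge> N" for m n
    proof -
      have "inverse (real (Suc m)) \<le> inverse (real (Suc N))"
           "inverse (real (Suc n)) \<le> inverse (real (Suc N))"
        using that by (auto intro!: le_imp_inverse_le)
      then have "(dist (X m) (X n))\<^sup>2 < e\<^sup>2"
        using close[of m n] N by argo
      then show ?thesis
        using \<open>e > 0\<close> by (simp add: power_less_imp_less_base)
    qed
    then show "\<exists>M. \<forall>m\<ge>M. \<forall>n\<ge>M. dist (X m) (X n) < e"
      by blast
  qed
  then obtain x where x: "X \<longlonglongrightarrow> x"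
    by (auto simp: Cauchy_convergent_iff convergent_def)
  have "x \<in> K"
    using closed_sequentially[OF K(2) _ x] X by blast
  have "(\<lambda>n. \<phi> (X n)) \<longlonglongrightarrow> \<phi> x"
    unfolding \<phi>_def by (intro tendsto_intros f.tendsto x)
  moreover have "(\<lambda>n. I + inverse (real (Suc n))) \<longlonglongrightarrow> I + 0"
    by (intro tendsto_intros LIMSEQ_inverse_real_of_nat)
  ultimately have "\<phi> x \<le> I + 0"
    by (rule LIMSEQ_le) (use X(2) less_imp_le in blast)
  have "inner x y = f y" if "y \<in> K" for y
  proof -
    \<comment> \<open>Minimality at \<open>x\<close> on the line \<open>x + t y\<close>.\<close>
    have "0 \<le> 2 * t * (inner x y - f y) + t\<^sup>2 * inner y y" for t
    proof -
      have "x + t *\<^sub>R y \<in> K"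
        using K(1) \<open>x \<in> K\<close> that by (intro subspace_scale subspace_add) auto
      then have "\<phi> x \<le> \<phi> (x + t *\<^sub>R y)"
        using I_le \<open>\<phi> x \<le> I + 0\<close> by fastforce
      then show ?thesis
        unfolding \<phi>_def
        by (simp add: inner_simps f.add f.scaleR inner_commute algebra_simps power2_eq_square)
    qed
    then have "inner x y - f y = 0"
      by (rule quadratic_nonneg_imp_linear_coeff_zero)
    then show ?thesis
      by simp
  qed
  then show thesis
    using that \<open>x \<in> K\<close> by blast
qed

corollary orthogonal_projection_exists:
  fixes K :: "'a::{real_inner, complete_space} set"
  assumes "subspace K" "closed K"
  obtains k where "k \<in> K" "\<And>y. y \<in> K \<Longrightarrow> inner (h - k) y = 0"
proof -
  obtain k where "k \<in> K" "\<And>y. y \<in> K \<Longrightarrow> inner k y = inner h y"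
    using riesz_on_closed_subspace[OF assms bounded_linear_inner_right[of h]] by blast
  then show thesis
    using that by (simp add: inner_diff_left)
qed

lemma subspace_closure:
  fixes S :: "'a::real_normed_vector set"
  assumes "subspace S"
  shows "subspace (closure S)"
proof (rule subspaceI)
  show "0 \<in> closure S"
    using assms closure_subset subspace_0 by blast
  fix x y
  assume "x \<in> closure S"
  then obtain X where X: "\<And>n. X n \<in> S" "X \<longlonglongrightarrow> x"
    by (auto simp: closure_sequential)
  show "c *\<^sub>R x \<in> closure S" for c
    unfolding closure_sequential
    by (intro exI[of _ "\<lambda>n. c *\<^sub>R X n"] conjI allI tendsto_intros X subspace_scale assms)
  assume "y \<in> closure S"
  then obtain Y where Y: "\<And>n. Y n \<in> S" "Y \<longlonglongrightarrow> y"
    by (auto simp: closure_sequential)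
  show "x + y \<in> closure S"
    unfolding closure_sequential
    by (intro exI[of _ "\<lambda>n. X n + Y n"] conjI allI tendsto_intros X Y subspace_add assms)
qed

section \<open>Contractions\<close>

lemma bounded_clinear_imp_bounded_linear:
  assumes "bounded_clinear T"
  shows "bounded_linear T"
proof -
  obtain K where "\<And>x. norm (T x) \<le> K * norm x"
    using assms by (auto simp: bounded_clinear_on_def)
  then show ?thesis
    using assms unfolding bounded_clinear_on_def
    by (intro bounded_linear_intro[of T K]) (auto simp: scaleR_scaleC mult.commute)
qed

lemma bounded_clinear_scaleC: "bounded_clinear T \<Longrightarrow> T (c *\<^sub>C x) = c *\<^sub>C T x"
  by (simp add: bounded_clinear_on_def)

lemma contraction_opI:
  assumes "\<And>x y. T (x + y) = T x + T y" "\<And>c x. T (c *\<^sub>C x) = c *\<^sub>C T x"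
    "\<And>x. norm (T x) \<le> norm x"
  shows "contraction_op T"
  unfolding contraction_op_def bounded_clinear_on_def
  using assms by (auto intro: exI[of _ 1])

lemma contraction_op_norm: "contraction_op T \<Longrightarrow> norm (T x) \<le> norm x"
  by (simp add: contraction_op_def)

lemma contraction_op_bounded_linear: "contraction_op T \<Longrightarrow> bounded_linear T"
  by (simp add: contraction_op_def bounded_clinear_imp_bounded_linear)

lemma contraction_op_scaleC: "contraction_op T \<Longrightarrow> T (c *\<^sub>C x) = c *\<^sub>C T x"
  by (simp add: contraction_op_def bounded_clinear_scaleC)

lemma contraction_op_compose:
  assumes "contraction_op S" "contraction_op T"
  shows "contraction_op (\<lambda>x. S (T x))"
proof (rule contraction_opI)
  show "norm (S (T x)) \<le> norm x" for x
    using contraction_op_norm[OF assms(1), of "T x"] contraction_op_norm[OF assms(2), of x] by simp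
qed (use assms in \<open>auto simp: contraction_op_def bounded_clinear_on_def\<close>)

lemma bounded_clinear_on_scaled_contraction:
  assumes "contraction_op C" "range C \<subseteq> F" "\<And>c x. x \<in> F \<Longrightarrow> c *\<^sub>C x \<in> F"
  shows "bounded_clinear_on E F (\<lambda>h. c *\<^sub>C C h)"
proof -
  have "norm (c *\<^sub>C C x) \<le> cmod c * norm x" for x
    by (simp add: norm_scaleC mult_left_mono contraction_op_norm[OF assms(1)])
  then show ?thesis
    using assms unfolding bounded_clinear_on_def contraction_op_def
    by (auto simp: scaleC_add_right scaleC_scaleC mult.commute intro: exI[of _ "cmod c"])
qed

section \<open>Adjoints\<close>

definition is_adjoint ::
  "('a::complex_inner \<Rightarrow> 'b::complex_inner) \<Rightarrow> ('b \<Rightarrow> 'a) \<Rightarrow> bool" where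
  "is_adjoint T S \<longleftrightarrow> (\<forall>x y. cinner (T x) y = cinner x (S y))"

lemma is_adjointD: "is_adjoint T S \<Longrightarrow> cinner (T x) y = cinner x (S y)"
  by (simp add: is_adjoint_def)

lemma is_adjointD2: "is_adjoint T S \<Longrightarrow> cinner (S x) y = cinner x (T y)"
  by (metis is_adjointD cinner_commute)

lemma is_adjoint_sym: "is_adjoint T S \<Longrightarrow> is_adjoint S T"
  using is_adjointD2[of T S] by (simp add: is_adjoint_def)

lemma cadjoint_eqI:
  assumes "is_adjoint T S"
  shows "cadjoint T = S"
  unfolding cadjoint_def
proof (rule the_equality)
  show "\<forall>x y. cinner (T x) y = cinner x (S y)"
    using assms by (simp add: is_adjoint_def)
  show "R = S" if "\<forall>x y. cinner (T x) y = cinner x (R y)" for R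
    by (rule ext, rule cinner_nondegenerate) (use that assms in \<open>simp add: is_adjoint_def\<close>)
qed

lemma is_adjoint_cadjoint:
  fixes T :: "'a::chilbert_space \<Rightarrow> 'b::complex_inner"
  assumes T: "bounded_clinear T"
  shows "is_adjoint T (cadjoint T)"
proof -
  interpret T: bounded_linear T
    by (rule bounded_clinear_imp_bounded_linear[OF T])
  have "\<exists>s. \<forall>x. cinner (T x) y = cinner x s" for y
  proof -
    have "bounded_linear (\<lambda>x. inner (T x) y)"
      by (rule bounded_linear_inner_left_comp) (rule T.bounded_linear_axioms)
    then obtain s where s: "\<And>x. inner x s = inner (T x) y"
      using riesz_on_closed_subspace[OF subspace_UNIV closed_UNIV] by (metis UNIV_I inner_commute)
    have "cinner (T x) y = cinner x s" for x
      using s[of x] s[of "\<i> *\<^sub>C x"]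
      by (simp add: inner_Re_cinner bounded_clinear_scaleC[OF T]
          cinner_scaleC_left complex_eq_iff)
    then show ?thesis
      by blast
  qed
  then obtain S where "\<And>x y. cinner (T x) y = cinner x (S y)"
    by metis
  then have "is_adjoint T S"
    by (simp add: is_adjoint_def)
  then show ?thesis
    by (simp add: cadjoint_eqI)
qed

lemma is_adjoint_add: "is_adjoint T S \<Longrightarrow> S (x + y) = S x + S y"
  by (rule cinner_nondegenerate) (simp add: cinner_add_right flip: is_adjointD)

lemma is_adjoint_scaleC: "is_adjoint T S \<Longrightarrow> S (c *\<^sub>C x) = c *\<^sub>C S x"
  by (rule cinner_nondegenerate) (simp add: cinner_scaleC_right flip: is_adjointD)

lemma contraction_op_adjoint:
  assumes T: "contraction_op T" and adj: "is_adjoint T S"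
  shows "contraction_op S"
proof (rule contraction_opI)
  show "norm (S x) \<le> norm x" for x
  proof -
    have "(norm (S x))\<^sup>2 = inner (T (S x)) x"
      by (simp add: power2_norm_eq_inner inner_Re_cinner is_adjointD[OF adj])
    also have "\<dots> \<le> norm (T (S x)) * norm x"
      by (rule norm_cauchy_schwarz)
    also have "\<dots> \<le> norm (S x) * norm x"
      by (intro mult_right_mono contraction_op_norm[OF T]) auto
    finally show ?thesis
      by (cases "norm (S x) = 0") (auto simp: power2_eq_square)
  qed
qed (rule is_adjoint_add[OF adj] is_adjoint_scaleC[OF adj])+

section \<open>Positive square roots\<close>

text \<open>
  Polarisation: the quadratic form is real on \<open>x + y\<close> and on \<open>x + \<i> y\<close>, which kills both the imaginary
  and the real part of \<open>\<langle>P x, y\<rangle> - \<langle>x, P y\<rangle>\<close>.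
\<close>

lemma positive_op_self_adjoint:
  assumes P: "positive_op P"
  shows "is_adjoint P P"
proof -
  have bP: "bounded_clinear P"
    using P by (simp add: positive_op_def)
  have real: "cinner (P z) z = cinner z (P z)" for z
    using P cinner_commute[of z "P z"] by (simp add: positive_op_def Reals_cnj_iff)
  have add: "P (x + y) = P x + P y" for x y
    using bP by (simp add: bounded_clinear_on_def)
  have Im_zero: "Im (cinner (P x) y - cinner x (P y)) = 0" for x y
    using real[of "x + y"] real[of x] real[of y]
      cinner_commute[of "P y" x] cinner_commute[of y "P x"]
    by (simp add: add cinner_add_left cinner_add_right complex_eq_iff)
  have "cinner (P x) y = cinner x (P y)" for x y
    using Im_zero[of x y] Im_zero[of x "\<i> *\<^sub>C y"]
    by (simp add: bounded_clinear_scaleC[OF bP] cinner_scaleC_right complex_eq_iff)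
  then show ?thesis
    by (simp add: is_adjoint_def)
qed

text \<open>
  Positivity on the line \<open>y + t P y\<close> forces the coefficient \<open>\<parallel>P y\<parallel>\<^sup>2\<close> of \<open>t\<close> to vanish.
\<close>

lemma positive_op_kernel:
  assumes P: "positive_op P" and y: "cinner (P y) y = 0"
  shows "P y = 0"
proof -
  interpret P: bounded_linear P
    using P by (intro bounded_clinear_imp_bounded_linear) (simp add: positive_op_def)
  have sa: "inner (P x) z = inner x (P z)" for x z
    using is_adjointD[OF positive_op_self_adjoint[OF P]] by (simp add: inner_Re_cinner)
  have "0 \<le> 2 * t * inner (P y) (P y) + t\<^sup>2 * inner (P (P y)) (P y)" for t
  proof -
    have "0 \<le> inner (P (y + t *\<^sub>R P y)) (y + t *\<^sub>R P y)"
      using P by (simp add: positive_op_def inner_Re_cinner)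
    also have "\<dots> = inner (P y) y + 2 * t * inner (P y) (P y) + t\<^sup>2 * inner (P (P y)) (P y)"
      by (simp add: P.add P.scaleR inner_simps sa power2_eq_square algebra_simps)
    finally show ?thesis
      using y by (simp add: inner_Re_cinner)
  qed
  then have "inner (P y) (P y) = 0"
    by (rule quadratic_nonneg_imp_linear_coeff_zero)
  then show ?thesis
    by simp
qed

text \<open>
  With \<open>y = S x - R x\<close> one has \<open>(S + R) y = (S\<^sup>2 - R\<^sup>2) x = 0\<close>, where commutation is used to multiply out.
  Two nonnegative numbers \<open>\<langle>S y, y\<rangle>\<close> and \<open>\<langle>R y, y\<rangle>\<close> with sum zero both vanish, so \<open>S y = R y = 0\<close>
  and \<open>\<parallel>y\<parallel>\<^sup>2 = \<langle>x, (S - R) y\<rangle> = 0\<close>.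
\<close>

lemma commuting_positive_sqrt_unique:
  assumes S: "positive_op S" and R: "positive_op R"
    and sq: "\<And>x. S (S x) = R (R x)" and comm: "\<And>x. S (R x) = R (S x)"
  shows "S = R"
proof (rule ext)
  fix x
  interpret S: bounded_linear S
    using S by (intro bounded_clinear_imp_bounded_linear) (simp add: positive_op_def)
  interpret R: bounded_linear R
    using R by (intro bounded_clinear_imp_bounded_linear) (simp add: positive_op_def)
  define y where "y = S x - R x"
  have "S y + R y = 0"
    by (simp add: y_def S.diff R.diff sq comm)
  then have "cinner (S y) y + cinner (R y) y = 0"
    by (simp flip: cinner_add_left)
  then have "Re (cinner (S y) y) + Re (cinner (R y) y) = 0"
    by (simp flip: plus_complex.sel)
  moreover have "cinner (S y) y \<in> \<real>" "0 \<le> Re (cinner (S y) y)"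
    "cinner (R y) y \<in> \<real>" "0 \<le> Re (cinner (R y) y)"
    using S R by (auto simp: positive_op_def)
  ultimately have "cinner (S y) y = 0" "cinner (R y) y = 0"
    by (auto simp: complex_eq_iff complex_is_Real_iff)
  then have "S y = 0" "R y = 0"
    using positive_op_kernel S R by blast+
  have "cinner y y = cinner (S x) y - cinner (R x) y"
    by (simp add: cinner_diff_left[symmetric] y_def)
  also have "\<dots> = cinner x (S y) - cinner x (R y)"
    by (simp add: is_adjointD[OF positive_op_self_adjoint[OF S]]
        is_adjointD[OF positive_op_self_adjoint[OF R]])
  also have "\<dots> = 0"
    by (simp add: \<open>S y = 0\<close> \<open>R y = 0\<close>)
  finally have "y = 0"
    by (simp add: cinner_eq_zero_iff)
  then show "S x = R x"
    by (simp add: y_def)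
qed

text \<open>
  The Taylor coefficients of \<open>\<surd>(1 - t)\<close> at \<open>0\<close>.  All of them except the first are \<open>\<le> 0\<close> while all partial
  sums are \<open>\<ge> 0\<close>; these two facts give absolute convergence at \<open>t = 1\<close>, hence on all contractions, and
  also positivity of the resulting operator.
\<close>

definition sqrt_coeff :: "nat \<Rightarrow> real" where
  "sqrt_coeff n = (1/2 gchoose n) * (- 1) ^ n"

lemma sqrt_coeff_0 [simp]: "sqrt_coeff 0 = 1"
  by (simp add: sqrt_coeff_def)

lemma sqrt_coeff_pochhammer: "sqrt_coeff n = pochhammer (- 1/2) n / fact n"
  by (simp add: sqrt_coeff_def gbinomial_pochhammer flip: power_mult_distrib)

lemma sqrt_coeff_nonpos: "n > 0 \<Longrightarrow> sqrt_coeff n \<le> 0"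
proof -
  assume "n > 0"
  then obtain k where n: "n = Suc k"
    by (cases n) auto
  have "pochhammer (1/2 :: real) k \<ge> 0"
    by (rule pochhammer_nonneg) simp
  then show ?thesis
    by (simp add: sqrt_coeff_pochhammer n pochhammer_rec divide_le_0_iff mult_le_0_iff)
qed

lemma sqrt_coeff_sum_nonneg: "(\<Sum>k\<le>n. sqrt_coeff k) \<ge> 0"
proof -
  have "(\<Sum>k\<le>n. sqrt_coeff k) = pochhammer (1/2) n / fact n"
    unfolding sqrt_coeff_def gbinomial_sum_lower_neg
    by (simp add: gbinomial_pochhammer flip: power_mult_distrib)
  also have "\<dots> \<ge> 0"
    by (intro divide_nonneg_nonneg less_imp_le[OF pochhammer_pos]) auto
  finally show ?thesis .
qed

lemma sqrt_coeff_summable: "summable (\<lambda>n. \<bar>sqrt_coeff n\<bar>)"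
proof (rule bounded_imp_summable)
  show "(\<Sum>k\<le>n. \<bar>sqrt_coeff k\<bar>) \<le> 2" for n
  proof -
    have "(\<Sum>k\<le>n. \<bar>sqrt_coeff k\<bar>) = (\<Sum>k\<le>n. (if k = 0 then 2 else 0) - sqrt_coeff k)"
      by (intro sum.cong refl) (use sqrt_coeff_nonpos in auto)
    also have "\<dots> = 2 - (\<Sum>k\<le>n. sqrt_coeff k)"
      by (simp add: sum_subtractf)
    finally show ?thesis
      using sqrt_coeff_sum_nonneg[of n] by simp
  qed
qed simp

text \<open>
  The square of the power series is \<open>1 - t\<close>, by the Vandermonde identity for \<open>1/2 + 1/2 = 1\<close>.
\<close>

lemma sqrt_coeff_convolution:
  "(\<Sum>k\<le>n. sqrt_coeff k * sqrt_coeff (n - k)) = (if n = 0 then 1 else if n = 1 then - 1 else 0)"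
proof -
  have "(\<Sum>k\<le>n. sqrt_coeff k * sqrt_coeff (n - k))
      = (\<Sum>k\<le>n. (1/2 gchoose k) * (1/2 gchoose (n - k)) * (- 1) ^ n)"
    by (intro sum.cong refl) (auto simp: sqrt_coeff_def mult_ac simp flip: power_add)
  also have "\<dots> = (1/2 + 1/2 gchoose n) * (- 1 :: real) ^ n"
    unfolding gbinomial_Vandermonde[of "1/2" "1/2 :: real" n, symmetric] sum_distrib_right atLeast0AtMost ..
  also have "\<dots> = of_nat (1 choose n) * (- 1) ^ n"
    by (simp add: binomial_gbinomial)
  also have "\<dots> = (if n = 0 then 1 else if n = 1 then - 1 else 0)"
    by (auto simp: binomial_eq_0)
  finally show ?thesis .
qed

text \<open>
  The operator \<open>\<surd>(I - B)\<close> for a contraction \<open>B\<close>.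
\<close>

definition sqrt_series :: "('a::chilbert_space \<Rightarrow> 'a) \<Rightarrow> 'a \<Rightarrow> 'a" where
  "sqrt_series B x = (\<Sum>n. sqrt_coeff n *\<^sub>R (B ^^ n) x)"

lemma contraction_op_funpow:
  fixes B :: "'a::complex_inner \<Rightarrow> 'a"
  assumes "contraction_op B"
  shows "contraction_op (B ^^ n)"
proof (induction n)
  case 0
  show ?case
    by (rule contraction_opI) auto
next
  case (Suc n)
  show ?case
  proof (rule contraction_opI)
    show "norm ((B ^^ Suc n) x) \<le> norm x" for x
      using contraction_op_norm[OF assms, of "(B ^^ n) x"] contraction_op_norm[OF Suc, of x] by simp
  qed (use assms Suc in \<open>auto simp: contraction_op_def bounded_clinear_on_def\<close>)
qed

lemma sqrt_series_norm_summable: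
  fixes B :: "'a::chilbert_space \<Rightarrow> 'a"
  assumes "contraction_op B"
  shows "summable (\<lambda>n. norm (sqrt_coeff n *\<^sub>R (B ^^ n) x))"
proof (rule summable_comparison_test')
  show "summable (\<lambda>n. \<bar>sqrt_coeff n\<bar> * norm x)"
    by (intro summable_mult2 sqrt_coeff_summable)
  show "norm (norm (sqrt_coeff n *\<^sub>R (B ^^ n) x)) \<le> \<bar>sqrt_coeff n\<bar> * norm x" for n
    using contraction_op_norm[OF contraction_op_funpow[OF assms], of n x] by (simp add: mult_left_mono)
qed

lemma sqrt_series_sums:
  fixes B :: "'a::chilbert_space \<Rightarrow> 'a"
  assumes "contraction_op B"
  shows "(\<lambda>n. sqrt_coeff n *\<^sub>R (B ^^ n) x) sums sqrt_series B x"
  unfolding sqrt_series_def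
  by (intro summable_sums summable_norm_cancel[OF sqrt_series_norm_summable[OF assms]])

text \<open>
  Intertwining passes to powers and hence to convergent power series.  With \<open>B = B'\<close> this says that the
  square root commutes with everything that commutes with \<open>B\<close>, which makes it unique; with \<open>B = A\<^sup>* A\<close>,
  \<open>B' = A A\<^sup>*\<close> and \<open>C = A\<close> it relates the two defect operators of \<open>A\<close>.
\<close>

lemma sqrt_series_intertwine:
  fixes B :: "'a::chilbert_space \<Rightarrow> 'a" and B' :: "'b::chilbert_space \<Rightarrow> 'b"
  assumes B: "contraction_op B" and B': "contraction_op B'"
    and C: "bounded_linear C" and CB: "\<And>x. C (B x) = B' (C x)"
  shows "C (sqrt_series B x) = sqrt_series B' (C x)"
proof -
  have "C ((B ^^ n) x) = (B' ^^ n) (C x)" for n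
    by (induction n) (simp_all add: CB)
  then have "(\<lambda>n. sqrt_coeff n *\<^sub>R (B' ^^ n) (C x)) sums C (sqrt_series B x)"
    using bounded_linear.sums[OF C sqrt_series_sums[OF B, of x]]
    by (simp add: linear_simps[OF C])
  then show ?thesis
    using sqrt_series_sums[OF B', of "C x"] sums_unique2 by blast
qed

lemma sqrt_series_bounded_clinear:
  fixes B :: "'a::chilbert_space \<Rightarrow> 'a"
  assumes B: "contraction_op B"
  shows "bounded_clinear (sqrt_series B)"
proof -
  let ?S = "sqrt_series B"
  have Bn: "(B ^^ n) (x + y) = (B ^^ n) x + (B ^^ n) y" "(B ^^ n) (c *\<^sub>C x) = c *\<^sub>C (B ^^ n) x"
    for n x y c
    using contraction_op_funpow[OF B, of n] by (auto simp: contraction_op_def bounded_clinear_on_def)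
  have "?S (x + y) = ?S x + ?S y" for x y
    using sums_add[OF sqrt_series_sums[OF B, of x] sqrt_series_sums[OF B, of y]]
      sqrt_series_sums[OF B, of "x + y"]
    by (simp add: Bn scaleR_add_right sums_iff)
  moreover have "?S (c *\<^sub>C x) = c *\<^sub>C ?S x" for c x
  proof -
    have C: "bounded_linear (\<lambda>x::'a. c *\<^sub>C x)"
      by (rule bounded_linear_intro[of _ "cmod c"])
        (auto simp: scaleC_add_right scaleR_scaleC scaleC_scaleC mult.commute norm_scaleC)
    have "B (c *\<^sub>C x) = c *\<^sub>C B x" for x
      using Bn(2)[of 1 c x] by simp
    then show ?thesis
      by (subst sqrt_series_intertwine[OF B B C]) auto
  qed
  moreover have "norm (?S x) \<le> (\<Sum>n. \<bar>sqrt_coeff n\<bar>) * norm x" for x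
  proof -
    have "norm (?S x) \<le> (\<Sum>n. norm (sqrt_coeff n *\<^sub>R (B ^^ n) x))"
      unfolding sqrt_series_def by (rule summable_norm[OF sqrt_series_norm_summable[OF B]])
    also have "\<dots> \<le> (\<Sum>n. \<bar>sqrt_coeff n\<bar> * norm x)"
      using contraction_op_norm[OF contraction_op_funpow[OF B], of _ x]
      by (intro suminf_le sqrt_series_norm_summable[OF B] summable_mult2 sqrt_coeff_summable)
        (simp add: mult_left_mono)
    also have "\<dots> = (\<Sum>n. \<bar>sqrt_coeff n\<bar>) * norm x"
      by (rule suminf_mult2[symmetric]) (rule sqrt_coeff_summable)
    finally show ?thesis .
  qed
  ultimately show ?thesis
    unfolding bounded_clinear_on_def by blast
qed

text \<open>
  The double series \<open>a\<^sub>i a\<^sub>j B\<^sup>i\<^sup>+\<^sup>j x\<close> converges absolutely, so it may be summed along rows, giving the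
  left-hand side, or along the diagonals \<open>i + j = n\<close>, giving the right-hand side.
\<close>

lemma sqrt_series_squared:
  fixes B :: "'a::chilbert_space \<Rightarrow> 'a"
  assumes B: "contraction_op B"
  shows "sqrt_series B (sqrt_series B x) = x - B x"
proof -
  let ?a = sqrt_coeff
  define f where "f = (\<lambda>(i, j). (?a i * ?a j) *\<^sub>R (B ^^ (i + j)) x)"
  have a: "(\<lambda>n. \<bar>?a n\<bar>) summable_on UNIV"
    by (rule norm_summable_imp_summable_on) (simp add: sqrt_coeff_summable)
  have "(\<lambda>(i, j). (\<bar>?a i\<bar> * \<bar>?a j\<bar>) * norm x) summable_on (UNIV \<times> UNIV)"
  proof (rule summable_on_SigmaI)
    show "((\<lambda>j. case (i, j) of (i, j) \<Rightarrow> \<bar>?a i\<bar> * \<bar>?a j\<bar> * norm x) has_sum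
        (\<bar>?a i\<bar> * infsum (\<lambda>n. \<bar>?a n\<bar>) UNIV * norm x)) UNIV" for i
      by (simp, intro has_sum_cmult_left has_sum_cmult_right has_sum_infsum a)
    show "(\<lambda>i. \<bar>?a i\<bar> * infsum (\<lambda>n. \<bar>?a n\<bar>) UNIV * norm x) summable_on UNIV"
      by (intro summable_on_cmult_left a)
  qed auto
  then have "(\<lambda>(i, j). (\<bar>?a i\<bar> * \<bar>?a j\<bar>) * norm x) summable_on UNIV"
    by simp
  then have "(\<lambda>p. norm (f p)) summable_on UNIV"
  proof (rule summable_on_comparison_test)
    show "norm (f p) \<le> (case p of (i, j) \<Rightarrow> \<bar>?a i\<bar> * \<bar>?a j\<bar> * norm x)" for p
    proof -
      obtain i j where p: "p = (i, j)"
        by (cases p)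
      have "norm ((B ^^ (i + j)) x) \<le> norm x"
        by (rule contraction_op_norm[OF contraction_op_funpow[OF B]])
      then show ?thesis
        by (simp add: p f_def abs_mult mult_left_mono)
    qed
  qed simp
  then have "f summable_on UNIV"
    by (rule abs_summable_summable)
  then obtain s where s: "(f has_sum s) UNIV"
    by (auto simp: summable_on_def)
  have series: "((\<lambda>n. ?a n *\<^sub>R (B ^^ n) y) has_sum sqrt_series B y) UNIV" for y
    by (rule norm_summable_imp_has_sum[OF sqrt_series_norm_summable[OF B] sqrt_series_sums[OF B]])
  have "((\<lambda>i. ?a i *\<^sub>R (B ^^ i) (sqrt_series B x)) has_sum s) UNIV"
  proof (rule has_sum_SigmaD)
    show "(f has_sum s) (UNIV \<times> UNIV)"
      using s by simp
    show "((\<lambda>j. f (i, j)) has_sum ?a i *\<^sub>R (B ^^ i) (sqrt_series B x)) UNIV" for i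
    proof -
      have "bounded_linear (\<lambda>y. ?a i *\<^sub>R (B ^^ i) y)"
        using contraction_op_funpow[OF B, of i]
        by (intro bounded_linear_const_scaleR bounded_clinear_imp_bounded_linear)
          (simp add: contraction_op_def)
      from has_sum_bounded_linear[OF this series[of x]] show ?thesis
        using contraction_op_funpow[OF B, of i]
        by (simp add: f_def o_def funpow_add contraction_op_def
            linear_simps[OF bounded_clinear_imp_bounded_linear])
    qed
  qed
  then have 1: "s = sqrt_series B (sqrt_series B x)"
    using series has_sum_unique by blast
  \<comment> \<open>Reindexing by \<open>n = i + j\<close> and \<open>k = i\<close>.\<close>
  have "((\<lambda>(n, k). f (k, n - k)) has_sum s) (SIGMA n:UNIV. {..n})"
    using s by (subst has_sum_reindex_bij_witness[of _ "\<lambda>(i, j). (i + j, i)" "\<lambda>(n, k). (k, n - k)" UNIV f])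
      auto
  then have "((\<lambda>n. \<Sum>k\<le>n. f (k, n - k)) has_sum s) UNIV"
    by (rule has_sum_SigmaD) (simp add: has_sum_finite_iff)
  also have "(\<lambda>n. \<Sum>k\<le>n. f (k, n - k)) = (\<lambda>n. (\<Sum>k\<le>n. ?a k * ?a (n - k)) *\<^sub>R (B ^^ n) x)"
    by (rule ext) (simp add: f_def scaleR_sum_left)
  finally have "((\<lambda>n. (if n = 0 then 1 else if n = 1 then - 1 else 0) *\<^sub>R (B ^^ n) x) has_sum s) UNIV"
    by (simp only: sqrt_coeff_convolution)
  then have "((\<lambda>n. (if n = 0 then 1 else if n = 1 then - 1 else 0) *\<^sub>R (B ^^ n) x) has_sum s) {0, 1}"
    by (subst has_sum_cong_neutral[of UNIV]) auto
  then have "s = x - B x"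
    by (simp add: has_sum_finite_iff)
  with 1 show ?thesis
    by simp
qed

text \<open>
  Since \<open>a\<^sub>n \<le> 0\<close> for \<open>n > 0\<close> and \<open>\<langle>B\<^sup>n x, x\<rangle> \<le> \<parallel>x\<parallel>\<^sup>2\<close>, the partial sums of \<open>\<Sum> a\<^sub>n \<langle>B\<^sup>n x, x\<rangle>\<close> are at least
  \<open>\<parallel>x\<parallel>\<^sup>2\<close> times the partial sums of \<open>\<Sum> a\<^sub>n\<close>, which are nonnegative.
\<close>

lemma sqrt_series_positive:
  fixes B :: "'a::chilbert_space \<Rightarrow> 'a"
  assumes B: "contraction_op B" and sa: "is_adjoint B B"
  shows "positive_op (sqrt_series B)"
  unfolding positive_op_def
proof (intro conjI allI)
  show "bounded_clinear (sqrt_series B)"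
    by (rule sqrt_series_bounded_clinear[OF B])
  fix x :: 'a
  have san: "cinner ((B ^^ n) y) z = cinner y ((B ^^ n) z)" for n y z
    by (induction n arbitrary: y z) (simp_all add: is_adjointD[OF sa] funpow_swap1)
  have "bounded_linear (\<lambda>y. cinner y x)"
  proof (rule bounded_linear_intro)
    show "norm (cinner y x) \<le> norm y * (2 * norm x)" for y
    proof -
      have "cmod (cinner y x) \<le> \<bar>inner y x\<bar> + \<bar>inner (\<i> *\<^sub>C y) x\<bar>"
        using cmod_le[of "cinner y x"] by (simp add: inner_Re_cinner cinner_scaleC_left)
      also have "\<dots> \<le> norm y * norm x + norm (\<i> *\<^sub>C y) * norm x"
        by (intro add_mono Cauchy_Schwarz_ineq2)
      finally show ?thesis
        by (simp add: norm_scaleC mult_ac)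
    qed
  qed (simp_all add: cinner_add_left scaleR_scaleC cinner_scaleC_left scaleC_complex_def)
  from bounded_linear.sums[OF this sqrt_series_sums[OF B, of x]]
  have sums: "(\<lambda>n. complex_of_real (sqrt_coeff n) * cinner ((B ^^ n) x) x) sums cinner (sqrt_series B x) x"
    by (simp add: scaleR_scaleC cinner_scaleC_left)
  have real: "cinner ((B ^^ n) x) x \<in> \<real>" for n
    using cinner_commute[of "(B ^^ n) x" x] by (simp add: Reals_cnj_iff san)
  have "Im (cinner (sqrt_series B x) x) = 0"
    using sums_Im[OF sums] real by (simp add: complex_is_Real_iff sums_iff)
  then show "cinner (sqrt_series B x) x \<in> \<real>"
    by (simp add: complex_is_Real_iff)
  have Re_sums: "(\<lambda>n. sqrt_coeff n * Re (cinner ((B ^^ n) x) x)) sums Re (cinner (sqrt_series B x) x)"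
    using sums_Re[OF sums] by simp
  have coeff_le: "sqrt_coeff n * (norm x)\<^sup>2 \<le> sqrt_coeff n * Re (cinner ((B ^^ n) x) x)" for n
  proof (cases "n = 0")
    case True
    then show ?thesis
      by (simp add: power2_norm_eq_inner inner_Re_cinner)
  next
    case False
    have "Re (cinner ((B ^^ n) x) x) \<le> norm ((B ^^ n) x) * norm x"
      unfolding inner_Re_cinner[symmetric] by (rule norm_cauchy_schwarz)
    also have "\<dots> \<le> norm x * norm x"
      by (intro mult_right_mono contraction_op_norm[OF contraction_op_funpow[OF B]]) auto
    finally show ?thesis
      using sqrt_coeff_nonpos[of n] False by (intro mult_left_mono_neg) (auto simp: power2_eq_square)
  qed
  show "0 \<le> Re (cinner (sqrt_series B x) x)"
  proof (rule LIMSEQ_le_const)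
    show "(\<lambda>N. \<Sum>n\<le>N. sqrt_coeff n * Re (cinner ((B ^^ n) x) x)) \<longlonglongrightarrow> Re (cinner (sqrt_series B x) x)"
      using Re_sums by (simp add: sums_def_le)
    have "0 \<le> (\<Sum>n\<le>N. sqrt_coeff n) * (norm x)\<^sup>2" for N
      by (intro mult_nonneg_nonneg sqrt_coeff_sum_nonneg) auto
    also have "(\<Sum>n\<le>N. sqrt_coeff n) * (norm x)\<^sup>2 \<le> (\<Sum>n\<le>N. sqrt_coeff n * Re (cinner ((B ^^ n) x) x))" for N
      unfolding sum_distrib_right by (intro sum_mono coeff_le)
    finally show "\<exists>N. \<forall>n\<ge>N. 0 \<le> (\<Sum>n\<le>n. sqrt_coeff n * Re (cinner ((B ^^ n) x) x))"
      by blast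
  qed
qed

section \<open>Defect operators\<close>

context
  fixes T :: "'a::chilbert_space \<Rightarrow> 'b::chilbert_space" and S :: "'b \<Rightarrow> 'a"
  assumes T: "contraction_op T" and adj: "is_adjoint T S"
begin

lemma contraction_op_gram: "contraction_op (\<lambda>x. S (T x))"
proof (rule contraction_opI)
  have S: "contraction_op S"
    by (rule contraction_op_adjoint[OF T adj])
  show "norm (S (T x)) \<le> norm x" for x
    using contraction_op_norm[OF S, of "T x"] contraction_op_norm[OF T, of x] by simp
qed (simp_all add: is_adjoint_add[OF adj] is_adjoint_add[OF is_adjoint_sym[OF adj]]
    is_adjoint_scaleC[OF adj] is_adjoint_scaleC[OF is_adjoint_sym[OF adj]])

lemma is_adjoint_gram: "is_adjoint (\<lambda>x. S (T x)) (\<lambda>x. S (T x))"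
  by (simp add: is_adjoint_def is_adjointD[OF adj] is_adjointD2[OF adj])

text \<open>
  A competing positive square root \<open>R\<close> commutes with \<open>R\<^sup>2 = I - T\<^sup>* T\<close>, hence with \<open>T\<^sup>* T\<close> and with the power
  series in it, so that the uniqueness of commuting positive square roots applies.
\<close>

lemma defect_op_eq_sqrt_series: "defect_op T = sqrt_series (\<lambda>x. S (T x))"
  unfolding defect_op_def cadjoint_eqI[OF adj] op_sqrt_def
proof (rule the_equality)
  let ?B = "\<lambda>x. S (T x)"
  have pos: "positive_op (sqrt_series ?B)"
    by (rule sqrt_series_positive[OF contraction_op_gram is_adjoint_gram])
  show "positive_op (sqrt_series ?B) \<and> sqrt_series ?B \<circ> sqrt_series ?B = (\<lambda>h. h - ?B h)"
    using pos by (auto simp: sqrt_series_squared[OF contraction_op_gram])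
  fix R
  assume R: "positive_op R \<and> R \<circ> R = (\<lambda>h. h - ?B h)"
  then have RR: "R (R x) = x - ?B x" for x
    by (metis comp_apply)
  interpret R: bounded_linear R
    using R by (intro bounded_clinear_imp_bounded_linear) (simp add: positive_op_def)
  have "R (?B x) = ?B (R x)" for x
  proof -
    have "R (x - ?B x) = R x - ?B (R x)"
      using RR[of "R x"] RR[of x] by simp
    then show ?thesis
      by (simp add: R.diff)
  qed
  then have "sqrt_series ?B (R x) = R (sqrt_series ?B x)" for x
    by (simp add: sqrt_series_intertwine[OF contraction_op_gram contraction_op_gram R.bounded_linear_axioms])
  then show "R = sqrt_series ?B"
    using R pos
    by (intro commuting_positive_sqrt_unique) (auto simp: RR sqrt_series_squared[OF contraction_op_gram])
qed

lemma positive_defect_op: "positive_op (defect_op T)"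
  unfolding defect_op_eq_sqrt_series
  by (rule sqrt_series_positive[OF contraction_op_gram is_adjoint_gram])

lemma defect_op_squared: "defect_op T (defect_op T x) = x - S (T x)"
  unfolding defect_op_eq_sqrt_series by (rule sqrt_series_squared[OF contraction_op_gram])

lemma norm_defect_op: "(norm (defect_op T x))\<^sup>2 = (norm x)\<^sup>2 - (norm (T x))\<^sup>2"
proof -
  have "cinner (defect_op T x) (defect_op T x) = cinner (defect_op T (defect_op T x)) x"
    by (simp add: is_adjointD[OF positive_op_self_adjoint[OF positive_defect_op]])
  also have "\<dots> = cinner x x - cinner (T x) (T x)"
    by (simp add: defect_op_squared cinner_diff_left is_adjointD2[OF adj])
  finally show ?thesis
    by (simp add: power2_norm_eq_inner inner_Re_cinner)
qed

lemma defect_op_idempotent: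
  assumes P: "positive_op P" and PP: "\<And>x. P (P x) = P x" and PT: "\<And>x. P x = x - S (T x)"
  shows "defect_op T = P"
proof (rule commuting_positive_sqrt_unique[OF positive_defect_op P])
  have sq: "defect_op T (defect_op T x) = P x" for x
    by (simp add: defect_op_squared PT)
  then show "defect_op T (defect_op T x) = P (P x)" "defect_op T (P x) = P (defect_op T x)" for x
    by (simp add: PP) (metis sq)
qed

end

lemma defect_op_intertwine:
  fixes T :: "'a::chilbert_space \<Rightarrow> 'b::chilbert_space"
  assumes T: "contraction_op T" and adj: "is_adjoint T S"
  shows "T (defect_op T x) = defect_op S (T x)"
proof -
  have S: "contraction_op S" and adj': "is_adjoint S T"
    using contraction_op_adjoint[OF T adj] is_adjoint_sym[OF adj] by auto
  show ?thesis
    unfolding defect_op_eq_sqrt_series[OF T adj] defect_op_eq_sqrt_series[OF S adj']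
    by (rule sqrt_series_intertwine[OF contraction_op_gram[OF T adj] contraction_op_gram[OF S adj']])
      (use T in \<open>auto simp: contraction_op_def intro: bounded_clinear_imp_bounded_linear\<close>)
qed

text \<open>
  Orthogonal projections, in the form of self-adjoint idempotents.
\<close>

context
  fixes P :: "'a::complex_inner \<Rightarrow> 'a"
  assumes adj: "is_adjoint P P" and idem: "\<And>x. P (P x) = P x"
begin

lemma projection_norm: "cinner (P x) x = complex_of_real ((norm (P x))\<^sup>2)"
  by (metis adj cinner_self idem is_adjointD)

lemma projection_contraction: "contraction_op P"
proof (rule contraction_opI)
  show "norm (P x) \<le> norm x" for x
  proof -
    have "(norm (P x))\<^sup>2 = inner (P x) x"
      by (simp add: inner_Re_cinner projection_norm)
    also have "\<dots> \<le> norm (P x) * norm x"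
      by (rule norm_cauchy_schwarz)
    finally show ?thesis
      by (cases "norm (P x) = 0") (auto simp: power2_eq_square)
  qed
qed (rule is_adjoint_add[OF adj] is_adjoint_scaleC[OF adj])+

lemma projection_positive: "positive_op P"
  using projection_contraction by (simp add: positive_op_def contraction_op_def projection_norm)

lemma projection_closed_range: "closure (range P) = range P"
proof -
  have "range P = {x. P x = x}"
    using idem by (auto intro: sym)
  moreover have "closed {x. P x = x}"
    by (intro closed_Collect_eq continuous_intros
        bounded_linear.continuous_on[OF contraction_op_bounded_linear[OF projection_contraction]])
  ultimately show ?thesis
    by simp
qed

end

text \<open>
  The identity \<open>T T\<^sup>* T = T\<close> makes \<open>I - T\<^sup>* T\<close> an orthogonal projection, which is its own positive square
  root.  This is how the defect operators of the model operator become computable.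
\<close>

lemma defect_of_partial_isometry:
  fixes T :: "'a::chilbert_space \<Rightarrow> 'b::chilbert_space"
  assumes T: "contraction_op T" and adj: "is_adjoint T S" and TST: "\<And>x. T (S (T x)) = T x"
  shows "defect_op T = (\<lambda>x. x - S (T x))"
    and "defect_space T = range (\<lambda>x. x - S (T x))"
proof -
  let ?P = "\<lambda>x. x - S (T x)"
  have "S 0 = 0"
    using is_adjoint_add[OF adj, of 0 0] by simp
  have T_diff: "T (x - y) = T x - T y" for x y
    by (rule linear_simps[OF contraction_op_bounded_linear[OF T]])
  have idem: "?P (?P x) = ?P x" for x
    by (simp add: T_diff TST \<open>S 0 = 0\<close>)
  have P: "is_adjoint ?P ?P"
    using is_adjoint_gram[OF T adj] by (simp add: is_adjoint_def cinner_diff_left cinner_diff_right)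
  show 1: "defect_op T = ?P"
    by (rule defect_op_idempotent[OF T adj projection_positive[OF P idem] idem refl])
  show "defect_space T = range ?P"
    unfolding defect_space_def 1 by (rule projection_closed_range[OF P idem])
qed

section \<open>The direct sum\<close>

lemma summand_pos: "n \<ge> 1 \<Longrightarrow> (0, y) \<in> summand n"
  by (simp add: summand_def)

lemma summand_nonpos: "n \<le> 0 \<Longrightarrow> (x, 0) \<in> summand n"
  by (simp add: summand_def)

lemma fst_entry: "n \<ge> 1 \<Longrightarrow> fst (entry h n) = 0"
  using entry_summand[of h n] by (auto simp: summand_def)

lemma snd_entry: "n \<le> 0 \<Longrightarrow> snd (entry h n) = 0"
  using entry_summand[of h n] by (auto simp: summand_def)

lemma cinner_incl:
  fixes h :: "('m::complex_inner, 'n::complex_inner) bisum"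
  assumes "x \<in> summand n"
  shows "cinner (incl n x) h = cinner x (entry h n)"
proof -
  have "cinner (incl n x) h = (\<Sum>\<^sub>\<infinity>k\<in>{n}. cinner (entry (incl n x) k) (entry h k))"
    unfolding cinner_bisum_def
    by (rule infsum_cong_neutral) (auto simp: entry_incl[OF assms])
  then show ?thesis
    by (simp add: entry_incl[OF assms])
qed

lemma norm_incl: "x \<in> summand n \<Longrightarrow> norm (incl n x) = norm x"
proof -
  assume x: "x \<in> summand n"
  have "(norm (incl n x))\<^sup>2 = (norm x)\<^sup>2"
    using cinner_incl[OF x, of "incl n x"] by (simp add: cinner_self entry_incl[OF x] del: of_real_power)
  then show ?thesis
    by simp
qed

lemma bounded_linear_entry: "bounded_linear (\<lambda>h. entry h n)"
  by (rule bounded_linear_intro[of _ 1]) (auto simp: entry_add entry_scaleR norm_entry_le)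

lemma closed_csubspace_subsum:
  "closed_csubspace (subsum I :: ('m::complex_inner, 'n::complex_inner) bisum set)"
  unfolding closed_csubspace_def
proof
  show "csubspace (subsum I :: ('m, 'n) bisum set)"
    by (auto simp: complex_vector.subspace_def subsum_def entry_zero entry_add entry_scaleC)
  have "subsum I = (\<Inter>n\<in>- I. {h :: ('m, 'n) bisum. entry h n = 0})"
    by (auto simp: subsum_def)
  moreover have "closed {h :: ('m, 'n) bisum. entry h n = 0}" for n
    by (intro closed_Collect_eq continuous_intros bounded_linear.continuous_on[OF bounded_linear_entry])
  ultimately show "closed (subsum I :: ('m, 'n) bisum set)"
    by (simp add: closed_INT)
qed

lemma incl_in_subsum: "x \<in> summand n \<Longrightarrow> n \<in> I \<Longrightarrow> incl n x \<in> subsum I"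
  by (auto simp: subsum_def entry_incl)

lemma subsum_orthogonal: "I \<inter> J = {} \<Longrightarrow> subsum I \<subseteq> orth_compl (subsum J)"
proof -
  assume "I \<inter> J = {}"
  then have "cinner x y = 0" if "x \<in> subsum I" "y \<in> subsum J" for x y
    unfolding cinner_bisum_def
    by (intro infsum_0) (use that in \<open>auto simp: subsum_def, metis IntI cinner_zero_left cinner_zero_right empty_iff\<close>)
  then show ?thesis
    by (auto simp: orth_compl_def)
qed

lemma orth_compl_subsum: "orth_compl (subsum I \<union> subsum J) = subsum (- (I \<union> J))"
proof
  show "orth_compl (subsum I \<union> subsum J) \<subseteq> subsum (- (I \<union> J))"
  proof
    fix h
    assume h: "h \<in> orth_compl (subsum I \<union> subsum J)"
    have "entry h n = 0" if "n \<in> I \<union> J" for n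
    proof -
      have "incl n (entry h n) \<in> subsum I \<union> subsum J"
        using that incl_in_subsum[OF entry_summand] by blast
      then have "cinner h (incl n (entry h n)) = 0"
        using h by (simp add: orth_compl_def)
      then have "cinner (incl n (entry h n)) h = 0"
        by (subst cinner_commute) simp
      then show ?thesis
        by (simp add: cinner_incl[OF entry_summand] cinner_eq_zero_iff)
    qed
    then show "h \<in> subsum (- (I \<union> J))"
      by (simp add: subsum_def)
  qed
  show "subsum (- (I \<union> J)) \<subseteq> orth_compl (subsum I \<union> subsum J)"
    using subsum_orthogonal[of "- (I \<union> J)" I] subsum_orthogonal[of "- (I \<union> J)" J]
    by (auto simp: orth_compl_def)
qed

lemma subsum_component_exists:
  fixes h :: "('m::complex_inner, 'n::complex_inner) bisum"
  shows "\<exists>x\<in>subsum I. \<forall>n. entry x n = (if n \<in> I then entry h n else 0)"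
proof -
  have "(\<lambda>n. (norm (if n \<in> I then entry h n else 0))\<^sup>2) summable_on UNIV"
    by (rule summable_on_comparison_test[OF entry_summable[of h]]) auto
  then have "entry (Abs_bisum (\<lambda>n. if n \<in> I then entry h n else 0)) =
      (\<lambda>n. if n \<in> I then entry h n else 0)"
    by (intro entry_Abs) (auto simp: summand_0 entry_summand)
  then show ?thesis
    by (intro bexI[of _ "Abs_bisum (\<lambda>n. if n \<in> I then entry h n else 0)"]) (auto simp: subsum_def)
qed

lemma orth_decomposition_subsum:
  assumes "I \<inter> J = {}" "I \<inter> K = {}" "J \<inter> K = {}" "I \<union> J \<union> K = UNIV"
  shows "orth_decomposition (subsum I) (subsum J) (subsum K)"
  unfolding orth_decomposition_def
proof (intro conjI allI closed_csubspace_subsum subsum_orthogonal assms)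
  fix h :: "('a, 'b) bisum"
  obtain x y z where xyz: "x \<in> subsum I" "y \<in> subsum J" "z \<in> subsum K"
    and ent: "\<And>n. entry x n = (if n \<in> I then entry h n else 0)"
      "\<And>n. entry y n = (if n \<in> J then entry h n else 0)"
      "\<And>n. entry z n = (if n \<in> K then entry h n else 0)"
    using subsum_component_exists[of I h] subsum_component_exists[of J h]
      subsum_component_exists[of K h] by blast
  have "h = x + y + z"
  proof (rule bisum_eqI)
    fix n
    have "n \<in> I \<and> n \<notin> J \<and> n \<notin> K \<or> n \<notin> I \<and> n \<in> J \<and> n \<notin> K \<or> n \<notin> I \<and> n \<notin> J \<and> n \<in> K"
      using assms by blast
    then show "entry h n = entry (x + y + z) n"
      by (auto simp: entry_add ent)
  qed
  then show "\<exists>x\<in>subsum I. \<exists>y\<in>subsum J. \<exists>z\<in>subsum K. h = x + y + z"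
    using xyz by blast
qed

section \<open>The model operator and its adjoint\<close>

text \<open>
  The model operator differs from a shift at two indices only.  This lemma reduces identities of
  inner products to those two indices.
\<close>

lemma infsum_eq_if_finite_change:
  fixes f g :: "'i \<Rightarrow> complex"
  assumes "f summable_on UNIV" "g summable_on UNIV" "finite F"
    and "\<And>n. n \<notin> F \<Longrightarrow> f n = g n" "sum f F = sum g F"
  shows "infsum f UNIV = infsum g UNIV"
proof -
  have "infsum f UNIV - infsum g UNIV = infsum (\<lambda>n. f n + - g n) UNIV"
    using assms(1,2) by (subst infsum_add) (simp_all add: summable_on_uminus infsum_uminus)
  also have "\<dots> = infsum (\<lambda>n. f n + - g n) F"
    by (rule infsum_cong_neutral) (use assms in auto)
  also have "\<dots> = 0"
    using assms by (simp add: sum_subtractf)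
  finally show ?thesis
    by simp
qed

lemma bij_shift: "bij_betw (\<lambda>n. n + 1) UNIV (UNIV :: int set)"
  by (rule bij_betw_byWitness[of _ "\<lambda>n. n - 1"]) auto

text \<open>
  The adjoint of the model operator, which is the backward shift, corrected at the
  index \<open>0\<close>, where the model operator has its kernel, and at the index \<open>-m\<close>, where the adjoint of the
  column \<open>-A \<oplus> D\<^sub>A\<close> acts.
\<close>

definition model_adj ::
  "nat \<Rightarrow> ('m::complex_inner \<Rightarrow> 'n::complex_inner) \<Rightarrow> ('m, 'n) bisum \<Rightarrow> ('m, 'n) bisum" where
  "model_adj m A h = Abs_bisum (\<lambda>n.
     if n = 0 then 0
     else if n = - int m
       then (defect_op A (fst (entry h (1 - int m))) - cadjoint A (snd (entry h 1)), 0)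
     else entry h (n + 1))"

lemma entry_model_adj:
  "entry (model_adj m A h) n =
    (if n = 0 then 0
     else if n = - int m
       then (defect_op A (fst (entry h (1 - int m))) - cadjoint A (snd (entry h 1)), 0)
     else entry h (n + 1))"
  unfolding model_adj_def
proof (subst entry_Abs)
  let ?f = "\<lambda>n. if n = 0 then 0
     else if n = - int m
       then (defect_op A (fst (entry h (1 - int m))) - cadjoint A (snd (entry h 1)), 0)
     else entry h (n + 1)"
  show "?f n \<in> summand n" for n
    using entry_summand[of h "n + 1"] by (auto simp: summand_def zero_prod_def split: if_splits)
  have "(\<lambda>n. (norm (entry h (n + 1)))\<^sup>2) summable_on UNIV"
    using entry_summable[of h] summable_on_reindex_bij_betw[OF bij_shift, of "\<lambda>n. (norm (entry h n))\<^sup>2"]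
    by simp
  then show "(\<lambda>n. (norm (?f n))\<^sup>2) summable_on UNIV"
    by (rule summable_on_finite_change[where F = "{0, - int m}"]) auto
qed (rule refl)

locale pure_model =
  fixes m :: nat and A :: "'m::chilbert_space \<Rightarrow> 'n::chilbert_space"
  assumes m: "m \<ge> 1" and pure: "pure_contraction A"
begin

abbreviation "T \<equiv> model_op m A"
abbreviation "Ts \<equiv> model_adj m A"
abbreviation "D \<equiv> defect_op A"
abbreviation "As \<equiv> cadjoint A"
abbreviation "Ds \<equiv> defect_op (cadjoint A)"

lemma A_contraction: "contraction_op A"
proof -
  have "bounded_clinear A"
    using pure by (simp add: pure_contraction_def)
  moreover from this have "A 0 = 0"
    by (intro linear_simps bounded_clinear_imp_bounded_linear)
  ultimately show ?thesis
    using pure unfolding contraction_op_def pure_contraction_def by (metis less_imp_le norm_zero order_refl)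
qed

lemma A_adjoint: "is_adjoint A As"
  using A_contraction by (simp add: contraction_op_def is_adjoint_cadjoint)

lemma As_contraction: "contraction_op As"
  by (rule contraction_op_adjoint[OF A_contraction A_adjoint])

lemma As_adjoint: "is_adjoint As A"
  by (rule is_adjoint_sym[OF A_adjoint])

lemma D_positive: "positive_op D"
  by (rule positive_defect_op[OF A_contraction A_adjoint])

lemma Ds_positive: "positive_op Ds"
  by (rule positive_defect_op[OF As_contraction As_adjoint])

lemma D_adjoint: "is_adjoint D D"
  by (rule positive_op_self_adjoint[OF D_positive])

lemma DD: "D (D x) = x - As (A x)"
  by (rule defect_op_squared[OF A_contraction A_adjoint])

lemma DsDs: "Ds (Ds y) = y - A (As y)"
  by (rule defect_op_squared[OF As_contraction As_adjoint])

lemma A_D: "A (D x) = Ds (A x)"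
  by (rule defect_op_intertwine[OF A_contraction A_adjoint])

lemma As_Ds: "As (Ds y) = D (As y)"
  by (rule defect_op_intertwine[OF As_contraction As_adjoint])

text \<open>
  This is where purity enters: \<open>\<parallel>D\<^sub>A x\<parallel>\<^sup>2 = \<parallel>x\<parallel>\<^sup>2 - \<parallel>A x\<parallel>\<^sup>2\<close> is positive for \<open>x \<noteq> 0\<close>.
\<close>

lemma D_injective: "D x = 0 \<Longrightarrow> x = 0"
  using norm_defect_op[OF A_contraction A_adjoint, of x] pure
  by (auto simp: pure_contraction_def)

sublocale A: bounded_linear A
  by (rule contraction_op_bounded_linear[OF A_contraction])

sublocale As: bounded_linear As
  by (rule contraction_op_bounded_linear[OF As_contraction])

sublocale D: bounded_linear D
  using D_positive by (intro bounded_clinear_imp_bounded_linear) (simp add: positive_op_def)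

sublocale Ds: bounded_linear Ds
  using Ds_positive by (intro bounded_clinear_imp_bounded_linear) (simp add: positive_op_def)

lemma entry_T:
  "entry (T h) n =
     (if n = 1 then (0, - A (fst (entry h (- int m))))
      else if n = 1 - int m then (D (fst (entry h (- int m))), 0)
      else entry h (n - 1))"
  by (simp add: entry_model_op model_entries_def)

lemma T_adjoint: "is_adjoint T Ts"
  unfolding is_adjoint_def
proof (intro allI)
  fix h g :: "('m, 'n) bisum"
  define f where "f n = cinner (entry (T h) n) (entry g n)" for n
  define f' where "f' n = cinner (entry h n) (entry (Ts g) n)" for n
  have "infsum (\<lambda>n. f (n + 1)) UNIV = infsum f' UNIV"
  proof (rule infsum_eq_if_finite_change[where F = "{0, - int m}"])
    show "(\<lambda>n. f (n + 1)) summable_on UNIV"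
      unfolding summable_on_reindex_bij_betw[OF bij_shift, of f]
      unfolding f_def by (rule cinner_bisum_summable)
    show "f' summable_on UNIV"
      unfolding f'_def by (rule cinner_bisum_summable)
    show "f (n + 1) = f' n" if "n \<notin> {0, - int m}" for n
      using that by (auto simp: f_def f'_def entry_T entry_model_adj)
    have "f 1 + f (1 - int m) = f' 0 + f' (- int m)"
      using m by (simp add: f_def f'_def entry_T entry_model_adj cinner_prod_def cinner_minus_left
          cinner_diff_right is_adjointD[OF A_adjoint] is_adjointD[OF D_adjoint])
    then show "(\<Sum>n\<in>{0, - int m}. f (n + 1)) = sum f' {0, - int m}"
      using m by (simp add: add.commute)
  qed simp
  then show "cinner (T h) g = cinner h (Ts g)"
    unfolding infsum_reindex_bij_betw[OF bij_shift, of f] unfolding cinner_bisum_def f_def f'_def .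
qed

text \<open>
  The column \<open>-A \<oplus> D\<^sub>A\<close> is isometric because \<open>A\<^sup>* A + D\<^sub>A\<^sup>2 = I\<close>, so the model operator only loses the
  component at index \<open>0\<close>.
\<close>

lemma Ts_T: "Ts (T h) = h - incl 0 (entry h 0)"
proof (rule bisum_eqI)
  fix n
  have "entry h (- int m) = (fst (entry h (- int m)), 0)"
    by (simp add: prod_eq_iff snd_entry)
  then show "entry (Ts (T h)) n = entry (h - incl 0 (entry h 0)) n"
    using m by (auto simp: entry_model_adj entry_T entry_minus entry_incl[OF entry_summand] DD A.neg As.neg
        simp del: prod.collapse)
qed

lemma T_norm: "(norm (T h))\<^sup>2 = (norm h)\<^sup>2 - (norm (entry h 0))\<^sup>2"
proof -
  have "cinner (T h) (T h) = cinner (h - incl 0 (entry h 0)) h"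
    by (simp add: is_adjointD2[OF T_adjoint] flip: Ts_T)
  also have "\<dots> = cinner h h - cinner (entry h 0) (entry h 0)"
    by (simp add: cinner_diff_left cinner_incl[OF entry_summand])
  finally show ?thesis
    by (simp add: power2_norm_eq_inner inner_Re_cinner)
qed

lemma T_contraction: "contraction_op T"
proof (rule contraction_opI)
  show "norm (T h) \<le> norm h" for h
    by (rule power2_le_imp_le) (simp_all add: T_norm)
qed (rule is_adjoint_add[OF is_adjoint_sym[OF T_adjoint]]
    is_adjoint_scaleC[OF is_adjoint_sym[OF T_adjoint]])+

lemma Ts_contraction: "contraction_op Ts"
  by (rule contraction_op_adjoint[OF T_contraction T_adjoint])

sublocale T: bounded_linear T
  by (rule contraction_op_bounded_linear[OF T_contraction])

sublocale Ts: bounded_linear Ts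
  by (rule contraction_op_bounded_linear[OF Ts_contraction])

lemma cadjoint_T: "cadjoint T = Ts"
  by (rule cadjoint_eqI[OF T_adjoint])

lemma T_L0: "T (incl 0 (entry h 0)) = 0"
proof -
  have "(norm (T (incl 0 (entry h 0))))\<^sup>2 = 0"
    by (simp add: T_norm norm_incl[OF entry_summand] entry_incl[OF entry_summand])
  then show ?thesis
    by simp
qed

lemma T_Ts_T: "T (Ts (T h)) = T h"
  by (simp add: Ts_T T.diff T_L0)

text \<open>
  The adjoint of the identity \<open>T T\<^sup>* T = T\<close>.
\<close>

lemma Ts_T_Ts: "Ts (T (Ts h)) = Ts h"
proof (rule cinner_nondegenerate)
  show "cinner x (Ts (T (Ts h))) = cinner x (Ts h)" for x
    by (simp add: T_Ts_T flip: is_adjointD[OF T_adjoint] is_adjointD2[OF T_adjoint])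
qed

lemma T_partial_isometry: "partial_isometry T"
  unfolding partial_isometry_def
proof (intro conjI ballI)
  show "bounded_clinear T"
    using T_contraction by (simp add: contraction_op_def)
  fix x
  assume "x \<in> orth_compl {y. T y = 0}"
  then have "cinner x (incl 0 (entry x 0)) = 0"
    by (simp add: orth_compl_def T_L0)
  then have "cinner (incl 0 (entry x 0)) x = 0"
    by (subst cinner_commute) simp
  then have "entry x 0 = 0"
    by (simp add: cinner_incl[OF entry_summand] cinner_eq_zero_iff)
  then have "(norm (T x))\<^sup>2 = (norm x)\<^sup>2"
    by (simp add: T_norm)
  then show "norm (T x) = norm x"
    by simp
qed

section \<open>The unilateral shift part and complete non-unitarity\<close>

lemma T_shift: "h \<in> subsum {j..} \<Longrightarrow> j \<ge> 1 \<Longrightarrow> T h \<in> subsum {j + 1..}"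
  using m by (auto simp: subsum_def entry_T A.zero D.zero zero_prod_def)

lemma T_power_shift: "h \<in> subsum {1..} \<Longrightarrow> (T ^^ k) h \<in> subsum {1 + int k..}"
proof (induction k)
  case (Suc k)
  then show ?case
    using T_shift[of "(T ^^ k) h" "1 + int k"] by (simp add: add_ac)
qed simp

text \<open>
  Each application of the model operator moves the component at index \<open>-j\<close> one place towards \<open>0\<close>; on the
  way it may pass through \<open>D\<^sub>A\<close>, which is injective.  A nonzero component at a nonpositive index would
  therefore be seen at index \<open>0\<close> after \<open>j\<close> steps.
\<close>

lemma entry_nonpos_zero:
  "(\<And>k. entry ((T ^^ k) h) 0 = 0) \<Longrightarrow> entry h (- int j) = 0"
proof (induction j arbitrary: h)
  case 0
  then show ?case
    using 0[of 0] by simp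
next
  case (Suc j)
  have "entry ((T ^^ k) (T h)) 0 = 0" for k
    using Suc.prems[of "Suc k"] by (simp add: funpow_swap1)
  then have 0: "entry (T h) (- int j) = 0"
    by (rule Suc.IH)
  show ?case
  proof (cases "- int j = 1 - int m")
    case True
    then have "D (fst (entry h (- int m))) = 0"
      using 0 m by (simp add: entry_T zero_prod_def)
    then have "fst (entry h (- int m)) = 0"
      by (rule D_injective)
    moreover have "- int m = - int (Suc j)"
      using True by simp
    ultimately show ?thesis
      by (simp add: prod_eq_iff snd_entry)
  next
    case False
    then have "entry (T h) (- int j) = entry h (- int j - 1)"
      by (simp add: entry_T)
    moreover have "- int j - 1 = - int (Suc j)"
      by simp
    ultimately show ?thesis
      using 0 by (simp del: of_nat_Suc)
  qed
qed

text \<open>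
  Norms are preserved at every step iff none of the iterates has a component at index \<open>0\<close>.
\<close>

lemma star_canonical_1_T: "star_canonical_1 T = subsum {1..}"
proof (intro set_eqI iffI)
  fix h
  have norm_step: "norm ((T ^^ (k + 1)) h) = norm ((T ^^ k) h) \<longleftrightarrow> entry ((T ^^ k) h) 0 = 0" for k
  proof -
    have "norm ((T ^^ (k + 1)) h) = norm ((T ^^ k) h) \<longleftrightarrow>
        (norm (T ((T ^^ k) h)))\<^sup>2 = (norm ((T ^^ k) h))\<^sup>2"
      by simp
    then show ?thesis
      unfolding T_norm by simp
  qed
  show "h \<in> subsum {1..}" if "h \<in> star_canonical_1 T"
  proof -
    have nonpos: "entry h (- int j) = 0" for j
      using that by (intro entry_nonpos_zero) (simp only: star_canonical_1_def norm_step mem_Collect_eq)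
    have "entry h n = 0" if "n < 1" for n
    proof -
      have "n = - int (nat (- n))"
        using that by simp
      then show ?thesis
        using nonpos[of "nat (- n)"] by simp
    qed
    then show ?thesis
      by (simp add: subsum_def)
  qed
  show "h \<in> star_canonical_1 T" if "h \<in> subsum {1..}"
  proof -
    have "entry ((T ^^ k) h) 0 = 0" for k
      using T_power_shift[OF that, of k] by (simp add: subsum_def)
    then show ?thesis
      by (simp only: star_canonical_1_def norm_step mem_Collect_eq simp_thms)
  qed
qed

text \<open>
  A reducing subspace \<open>S\<close> on which the operator is unitary lies in the space where all powers are
  isometric, \<open>\<Oplus>n\<ge>1. L\<^sub>n\<close>, and is contained in the range of each power restricted to \<open>S\<close>.  On
  \<open>\<Oplus>n\<ge>1. L\<^sub>n\<close> the operator is a pure shift, so \<open>S = {0}\<close>.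
\<close>

lemma T_cnu: "cnu_contraction T"
  unfolding cnu_contraction_def
proof (intro conjI notI T_contraction)
  assume "\<exists>S. reducing T S \<and> S \<noteq> {0} \<and> unitary_on S S T"
  then obtain S where S: "reducing T S" "S \<noteq> {0}" and U: "unitary_on S S T"
    by blast
  have TS: "T ` S = S" and iso: "\<And>x. x \<in> S \<Longrightarrow> norm (T x) = norm x"
    using U by (auto simp: unitary_on_def)
  have power: "(T ^^ k) ` S = S" for k
  proof (induction k)
    case (Suc k)
    then show ?case
      using TS by (metis funpow.simps(2) image_comp)
  qed simp
  \<comment> \<open>All iterates of a vector of \<open>S\<close> stay in \<open>S\<close>, where norms are preserved.\<close>
  have sub: "S \<subseteq> subsum {1..}"
    unfolding star_canonical_1_T[symmetric] star_canonical_1_def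
    using power iso by fastforce
  have "h = 0" if "h \<in> S" for h
  proof (rule bisum_eqI)
    fix n
    \<comment> \<open>Writing \<open>h\<close> as an \<open>n\<close>-th iterate of a vector of \<open>S\<close> pushes its entries beyond the index \<open>n\<close>.\<close>
    obtain g where "g \<in> S" "h = (T ^^ nat n) g"
      using power[of "nat n"] \<open>h \<in> S\<close> by blast
    then have "h \<in> subsum {1 + int (nat n)..}"
      using sub T_power_shift by blast
    then show "entry h n = entry 0 n"
      by (simp add: subsum_def entry_zero)
  qed
  moreover have "0 \<in> S"
    using S(1) by (simp add: reducing_def closed_csubspace_def complex_vector.subspace_def)
  ultimately show False
    using S(2) by blast
qed

section \<open>The characteristic function\<close>

lemma minus_Ts_T: "h - Ts (T h) = incl 0 (entry h 0)"
  unfolding Ts_T by simp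

lemma defect_op_T: "defect_op T = (\<lambda>h. incl 0 (entry h 0))"
  using defect_of_partial_isometry(1)[where T = T and S = Ts, OF T_contraction T_adjoint T_Ts_T] unfolding minus_Ts_T .

lemma L0_incl:
  assumes "h \<in> subsum {0}"
  shows "incl 0 (entry h 0) = h" "incl 0 (fst (entry h 0), 0) = h"
proof -
  show 1: "incl 0 (entry h 0) = h"
    by (rule bisum_eqI) (use assms in \<open>simp add: entry_incl[OF entry_summand] subsum_def\<close>)
  have "(fst (entry h 0), 0) = entry h 0"
    by (simp add: prod_eq_iff snd_entry)
  then show "incl 0 (fst (entry h 0), 0) = h"
    using 1 by simp
qed

lemma defect_space_T: "defect_space T = subsum {0}"
proof -
  have "defect_space T = range (\<lambda>h. incl 0 (entry h 0))"
    using defect_of_partial_isometry(2)[where T = T and S = Ts, OF T_contraction T_adjoint T_Ts_T] unfolding minus_Ts_T .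
  also have "\<dots> = subsum {0}"
  proof
    show "range (\<lambda>h. incl 0 (entry h 0)) \<subseteq> subsum {0}"
      by (auto intro: incl_in_subsum entry_summand)
    show "subsum {0} \<subseteq> range (\<lambda>h. incl 0 (entry h 0))"
      using L0_incl(1) by (metis rangeI subsetI)
  qed
  finally show ?thesis .
qed

text \<open>
  The column \<open>D\<^bsub>A*\<^esub> \<oplus> A\<^sup>*\<close> into \<open>L\<^sub>1 \<oplus> L\<^bsub>-m+1\<^esub>\<close> complements the column \<open>-A \<oplus> D\<^sub>A\<close> to the unitary Julia operator
  of \<open>A\<close>.  Its range is therefore the kernel of the adjoint of the model operator.
\<close>

definition W :: "'n \<Rightarrow> ('m, 'n) bisum" where
  "W g = incl 1 (0, Ds g) + incl (1 - int m) (As g, 0)"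

text \<open>
  The adjoint of \<open>W\<close>, which is its inverse on the range of \<open>W\<close>.
\<close>

definition V :: "('m, 'n) bisum \<Rightarrow> 'n" where
  "V h = Ds (snd (entry h 1)) + A (fst (entry h (1 - int m)))"

lemma entry_W:
  "entry (W g) n = (if n = 1 then (0, Ds g) else if n = 1 - int m then (As g, 0) else 0)"
  using m by (simp add: W_def entry_add entry_incl summand_pos summand_nonpos)

lemma V_W: "V (W g) = g"
  using m by (simp add: V_def entry_W DsDs)

text \<open>
  The relations \<open>A D\<^sub>A = D\<^bsub>A*\<^esub> A\<close> and \<open>A\<^sup>* D\<^bsub>A*\<^esub> = D\<^sub>A A\<^sup>*\<close> make the off-diagonal terms match.
\<close>

lemma W_V: "W (V h) = h - T (Ts h)"
proof (rule bisum_eqI)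
  fix n
  have "entry h 1 = (0, snd (entry h 1))" "entry h (1 - int m) = (fst (entry h (1 - int m)), 0)"
    using m by (simp_all add: prod_eq_iff snd_entry fst_entry)
  then show "entry (W (V h)) n = entry (h - T (Ts h)) n"
    using m by (auto simp: entry_W V_def entry_minus entry_T entry_model_adj Ds.add As.add
        DsDs DD A.diff D.diff A_D As_Ds prod_eq_iff)
qed

lemma norm_W: "norm (W g) = norm g"
proof -
  have "cinner (W g) (W g) = cinner (0, Ds g) (entry (W g) 1) + cinner (As g, 0) (entry (W g) (1 - int m))"
    using m by (subst (1) W_def) (simp add: cinner_add_left cinner_incl summand_pos summand_nonpos)
  also have "\<dots> = cinner (Ds g) (Ds g) + cinner (As g) (As g)"
    using m by (simp add: entry_W cinner_prod_def)
  finally have "(norm (W g))\<^sup>2 = (norm (Ds g))\<^sup>2 + (norm (As g))\<^sup>2"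
    by (simp add: cinner_self flip: of_real_add of_real_power)
  then have "(norm (W g))\<^sup>2 = (norm g)\<^sup>2"
    by (simp add: norm_defect_op[OF As_contraction As_adjoint])
  then show ?thesis
    by simp
qed

lemma W_contraction: "contraction_op W"
proof (rule contraction_opI)
  show "W (x + y) = W x + W y" for x y
    by (rule bisum_eqI) (simp add: entry_W entry_add Ds.add As.add)
  show "W (c *\<^sub>C x) = c *\<^sub>C W x" for c x
    using Ds_positive
    by (intro bisum_eqI) (simp add: entry_W entry_scaleC scaleC_prod_def zero_prod_def
        contraction_op_scaleC[OF As_contraction] positive_op_def bounded_clinear_scaleC)
qed (simp add: norm_W)

lemma defect_op_Ts: "defect_op Ts = (\<lambda>h. W (V h))"
  unfolding defect_of_partial_isometry(1)[where T = Ts and S = T,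
        OF Ts_contraction is_adjoint_sym[OF T_adjoint] Ts_T_Ts]
  unfolding W_V ..

lemma defect_space_Ts: "defect_space Ts = range W"
proof -
  have "defect_space Ts = range (\<lambda>h. W (V h))"
    unfolding defect_of_partial_isometry(2)[where T = Ts and S = T,
        OF Ts_contraction is_adjoint_sym[OF T_adjoint] Ts_T_Ts]
    unfolding W_V ..
  also have "\<dots> = range W"
  proof
    show "range W \<subseteq> range (\<lambda>h. W (V h))"
      by (rule image_subsetI) (metis V_W rangeI)
  qed auto
  finally show ?thesis .
qed

text \<open>
  Solving \<open>g = h + z T\<^sup>* g\<close> is a fixed point problem for a map with Lipschitz constant \<open>|z| < 1\<close>.
\<close>

lemma resolvent_surj:
  assumes "cmod z < 1"
  shows "surj (\<lambda>x. x - z *\<^sub>C Ts x)"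
  unfolding surj_def
proof
  fix h
  have "\<exists>!g. h + z *\<^sub>C Ts g = g"
  proof (rule banach_fix_type[of "cmod z"])
    show "\<forall>x y. dist (h + z *\<^sub>C Ts x) (h + z *\<^sub>C Ts y) \<le> cmod z * dist x y"
    proof (intro allI)
      fix x y
      have "dist (h + z *\<^sub>C Ts x) (h + z *\<^sub>C Ts y) = norm (z *\<^sub>C Ts (x - y))"
        by (simp add: dist_norm Ts.diff complex_vector.scale_right_diff_distrib)
      also have "\<dots> \<le> cmod z * norm (x - y)"
        by (simp add: norm_scaleC mult_left_mono contraction_op_norm[OF Ts_contraction])
      finally show "dist (h + z *\<^sub>C Ts x) (h + z *\<^sub>C Ts y) \<le> cmod z * dist x y"
        by (simp add: dist_norm)
    qed
  qed (use assms in auto)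
  then show "\<exists>g. h = g - z *\<^sub>C Ts g"
    by (metis add_diff_cancel_right')
qed

text \<open>
  The equation \<open>g = h + z T\<^sup>* g\<close> is a recursion for the entries of \<open>g\<close>.  Descending from index \<open>0\<close> it
  multiplies by \<open>z\<close> at each step until index \<open>-m + 1\<close>.  At positive indices it gives
  \<open>g\<^sub>1 = z\<^sup>k g\<^bsub>1+k\<^esub>\<close> for all \<open>k\<close>, so \<open>g\<^sub>1 = 0\<close> by boundedness of the entries.  These two entries of \<open>g\<close> are
  the only ones on which \<open>V\<close> depends.
\<close>

lemma resolvent_entries:
  assumes z: "cmod z < 1" and g: "g - z *\<^sub>C Ts g = h" and h: "h \<in> subsum {0}"
  shows "entry g 1 = 0" and "entry g (1 - int m) = z ^ (m - 1) *\<^sub>C entry h 0"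
proof -
  have rec: "entry g n = entry h n + z *\<^sub>C entry (Ts g) n" for n
    by (simp add: entry_minus entry_scaleC flip: g)
  have shift: "entry g n = z *\<^sub>C entry g (n + 1)" if "n \<noteq> 0" "n \<noteq> - int m" for n
    using rec[of n] that h by (simp add: entry_model_adj subsum_def)
  \<comment> \<open>An unbounded number of steps to the right costs the factor \<open>z\<^sup>k\<close>, which tends to \<open>0\<close>.\<close>
  have pos: "entry g 1 = z ^ k *\<^sub>C entry g (1 + int k)" for k
  proof (induction k)
    case (Suc k)
    then show ?case
      using shift[of "1 + int k"] by (simp add: scaleC_scaleC mult.commute add_ac)
  qed (simp add: scaleC_one)
  have "norm (entry g 1) \<le> cmod z ^ k * norm g" for k
    unfolding pos[of k] by (simp add: norm_scaleC norm_power mult_left_mono norm_entry_le)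
  moreover have "(\<lambda>k. cmod z ^ k * norm g) \<longlonglongrightarrow> 0 * norm g"
    by (intro tendsto_intros LIMSEQ_power_zero) (use z in auto)
  ultimately have "norm (entry g 1) \<le> 0 * norm g"
    by (intro LIMSEQ_le_const[of _ "0 * norm g"]) auto
  then show "entry g 1 = 0"
    by simp
  have neg: "entry g (- int k) = z ^ k *\<^sub>C entry h 0" if "k < m" for k
    using that
  proof (induction k)
    case 0
    show ?case
      using rec[of 0] by (simp add: entry_model_adj scaleC_one complex_vector.scale_zero_right)
  next
    case (Suc k)
    then show ?case
      using shift[of "- int (Suc k)"] by (simp add: scaleC_scaleC)
  qed
  then show "entry g (1 - int m) = z ^ (m - 1) *\<^sub>C entry h 0"
    using neg[of "m - 1"] m by (simp add: of_nat_diff)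
qed

text \<open>
  On \<open>L\<^sub>0\<close> the summand \<open>-T\<close> vanishes, \<open>D\<^sub>T\<close> is the identity, and \<open>D\<^bsub>T*\<^esub> = W V\<close> sees only the entry
  \<open>z\<^bsup>m-1\<^esup> x\<close> of the resolvent at index \<open>-m + 1\<close>, which \<open>V\<close> maps to \<open>z\<^bsup>m-1\<^esup> A x\<close>.
\<close>

lemma char_fun_T:
  assumes z: "cmod z < 1" and h: "h \<in> subsum {0}"
  shows "char_fun T z h = z ^ m *\<^sub>C W (A (fst (entry h 0)))"
proof -
  note h_incl = L0_incl(1)[OF h]
  define g where "g = inv (\<lambda>x. x - z *\<^sub>C Ts x) h"
  have "g - z *\<^sub>C Ts g = h"
    unfolding g_def by (rule surj_f_inv_f[OF resolvent_surj[OF z]])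
  note g = resolvent_entries[OF z this h]
  have "V g = z ^ (m - 1) *\<^sub>C A (fst (entry h 0))"
    by (simp add: V_def g Ds.zero scaleC_prod_def contraction_op_scaleC[OF A_contraction])
  then have "z *\<^sub>C W (V g) = (z * z ^ (m - 1)) *\<^sub>C W (A (fst (entry h 0)))"
    by (simp add: contraction_op_scaleC[OF W_contraction] scaleC_scaleC)
  also have "z * z ^ (m - 1) = z ^ m"
    using m by (simp add: power_eq_if)
  finally have "z *\<^sub>C W (V g) = z ^ m *\<^sub>C W (A (fst (entry h 0)))" .
  moreover have "T h = 0"
    using T_L0[of h] by (simp add: h_incl)
  ultimately show ?thesis
    by (simp add: char_fun_def cadjoint_T defect_op_Ts defect_op_T h_incl g_def)
qed

lemma fst_entry_contraction: "contraction_op (\<lambda>h :: ('m, 'n) bisum. fst (entry h 0))"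
proof (rule contraction_opI)
  show "norm (fst (entry h 0)) \<le> norm h" for h :: "('m, 'n) bisum"
    using norm_fst_le[of "fst (entry h 0)" "snd (entry h 0)"] norm_entry_le[of h 0] by simp
qed (simp_all add: entry_add entry_scaleC scaleC_prod_def)

lemma W_A_contraction: "contraction_op (\<lambda>h :: ('m, 'n) bisum. W (A (fst (entry h 0))))"
  by (rule contraction_op_compose[OF W_contraction
        contraction_op_compose[OF A_contraction fst_entry_contraction]])

lemma range_W_scaleC: "x \<in> range W \<Longrightarrow> c *\<^sub>C x \<in> range W"
  by (metis contraction_op_scaleC[OF W_contraction] rangeE rangeI)

text \<open>
  The unitaries are the identification of \<open>L\<^sub>0\<close> with its entries and \<open>V\<close>.
\<close>

lemma char_fun_coincides:
  "coincide (defect_space T) (defect_space (cadjoint T)) (char_fun T)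
    UNIV UNIV (\<lambda>z h. z ^ m *\<^sub>C A h)"
  unfolding coincide_def cadjoint_T defect_space_T defect_space_Ts
proof (intro conjI exI)
  show "operator_valued (subsum {0}) (range W) (char_fun T)"
    unfolding operator_valued_def
  proof
    fix z :: complex
    assume "z \<in> ball 0 1"
    then have z: "cmod z < 1"
      by simp
    have "bounded_clinear_on (subsum {0}) (range W) (\<lambda>h :: ('m, 'n) bisum. z ^ m *\<^sub>C W (A (fst (entry h 0))))"
      by (intro bounded_clinear_on_scaled_contraction[where C = "\<lambda>h :: ('m, 'n) bisum. W (A (fst (entry h 0)))"]
          W_A_contraction range_W_scaleC) auto
    moreover have "csubspace (subsum {0} :: ('m, 'n) bisum set)"
      by (rule closed_csubspace_subsum[unfolded closed_csubspace_def, THEN conjunct1])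
    ultimately show "bounded_clinear_on (subsum {0}) (range W) (char_fun T z)"
      unfolding bounded_clinear_on_def
      by (simp add: char_fun_T[OF z] complex_vector.subspace_add complex_vector.subspace_scale)
  qed
  show "operator_valued UNIV UNIV (\<lambda>z h. z ^ m *\<^sub>C A h)"
    unfolding operator_valued_def
    by (intro ballI bounded_clinear_on_scaled_contraction[OF A_contraction]) auto
  show "unitary_on (subsum {0}) UNIV (\<lambda>h :: ('m, 'n) bisum. fst (entry h 0))"
    unfolding unitary_on_def
  proof (intro conjI ballI)
    show "bounded_clinear_on (subsum {0}) UNIV (\<lambda>h :: ('m, 'n) bisum. fst (entry h 0))"
      using fst_entry_contraction by (auto simp: contraction_op_def bounded_clinear_on_def)
    have "x \<in> (\<lambda>h :: ('m, 'n) bisum. fst (entry h 0)) ` subsum {0}" for x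
      by (rule image_eqI[of _ _ "incl 0 (x, 0)"])
        (auto simp: entry_incl summand_nonpos intro: incl_in_subsum)
    then show "(\<lambda>h :: ('m, 'n) bisum. fst (entry h 0)) ` subsum {0} = UNIV"
      by blast
    show "norm (fst (entry h 0)) = norm h" if "h \<in> subsum {0}" for h :: "('m, 'n) bisum"
      using norm_incl[of "(fst (entry h 0), 0 :: 'n)" 0, OF summand_nonpos]
      unfolding L0_incl(2)[OF that] by (simp add: norm_Pair)
  qed
  show "unitary_on (range W) UNIV V"
    unfolding unitary_on_def bounded_clinear_on_def
  proof (intro conjI ballI allI exI)
    fix x y c
    assume "x \<in> range W"
    then obtain a where a: "x = W a"
      by blast
    show "V (c *\<^sub>C x) = c *\<^sub>C V x"
      unfolding a contraction_op_scaleC[OF W_contraction, symmetric] V_W ..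
    show "norm (V x) \<le> 1 * norm x" "norm (V x) = norm x"
      unfolding a V_W norm_W by simp_all
    assume "y \<in> range W"
    then obtain b where b: "y = W b"
      by blast
    show "V (x + y) = V x + V y"
      unfolding a b V_W linear_simps(1)[OF contraction_op_bounded_linear[OF W_contraction], symmetric] ..
  next
    show "V ` range W = UNIV"
      by (auto simp: image_image V_W)
  qed auto
  show "\<forall>z\<in>ball 0 1. \<forall>h\<in>subsum {0}. V (char_fun T z h) = z ^ m *\<^sub>C A (fst (entry h 0))"
    by (simp add: char_fun_T contraction_op_scaleC[OF W_contraction, symmetric] V_W)
qed

lemma char_fun_polynomial:
  assumes "A \<noteq> (\<lambda>_. 0)"
  shows "op_polynomial (defect_space T) (defect_space (cadjoint T)) (char_fun T) m"
  unfolding op_polynomial_def cadjoint_T defect_space_T defect_space_Ts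
proof (intro exI conjI allI impI ballI)
  let ?C = "\<lambda>k (h :: ('m, 'n) bisum). (if k = m then 1 else 0) *\<^sub>C W (A (fst (entry h 0)))"
  show "bounded_clinear_on (subsum {0}) (range W) (?C k)" for k
    by (intro bounded_clinear_on_scaled_contraction[where C = "\<lambda>h :: ('m, 'n) bisum. W (A (fst (entry h 0)))"]
        W_A_contraction range_W_scaleC) auto
  obtain x where "A x \<noteq> 0"
    using assms by blast
  then have "W (A x) \<noteq> 0"
    using norm_W[of "A x"] by auto
  then show "\<exists>h\<in>subsum {0}. ?C m h \<noteq> 0"
    by (intro bexI[of _ "incl 0 (x, 0)"])
      (auto simp: entry_incl summand_nonpos scaleC_one intro: incl_in_subsum)
  fix z :: complex and h :: "('m, 'n) bisum"
  assume "z \<in> ball 0 1" "h \<in> subsum {0}"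
  then have "char_fun T z h = z ^ m *\<^sub>C W (A (fst (entry h 0)))"
    by (simp add: char_fun_T)
  also have "\<dots> = (\<Sum>k\<le>m. if k = m then z ^ m *\<^sub>C W (A (fst (entry h 0))) else 0)"
    by simp
  also have "\<dots> = (\<Sum>k\<le>m. z ^ k *\<^sub>C ?C k h)"
    by (intro sum.cong refl) (simp add: scaleC_scaleC)
  finally show "char_fun T z h = (\<Sum>k\<le>m. z ^ k *\<^sub>C ?C k h)" .
qed

section \<open>The canonical decomposition\<close>

lemma Ts_incl:
  assumes "n \<le> 0"
  shows "Ts (incl n (x, 0)) = incl (n - 1) (if n = 1 - int m then D x else x, 0)"
  by (rule bisum_eqI)
    (use assms m in \<open>auto simp: entry_model_adj entry_incl summand_nonpos As.zero D.zero zero_prod_def\<close>)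

text \<open>
  A vector of \<open>L\<^sub>0\<close> is shifted backwards and picks up one factor \<open>D\<^sub>A\<close> when it enters \<open>L\<^bsub>-m\<^esub>\<close>.
\<close>

lemma Ts_power_incl: "(Ts ^^ k) (incl 0 (x, 0)) = incl (- int k) (if k < m then x else D x, 0)"
proof (induction k)
  case (Suc k)
  have "incl (- int (Suc k)) y = incl (- int k - 1) y" for y :: "'m \<times> 'n"
    by (rule arg_cong[where f = "\<lambda>n. incl n y"]) simp
  with Suc show ?case
    using m by (auto simp: Ts_incl simp del: of_nat_Suc)
qed (use m in simp)

text \<open>
  The spanning vectors are \<open>D\<^sub>A x\<close> placed at an index \<open>-k \<le> -m\<close>.  A vector \<open>l\<close> of \<open>\<Oplus>n\<le>-m. L\<^sub>n\<close> orthogonal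
  to all of them satisfies \<open>\<langle>x, D\<^sub>A l\<^sub>n\<rangle> = 0\<close> for all \<open>x\<close>, so \<open>D\<^sub>A l\<^sub>n = 0\<close> and \<open>l\<^sub>n = 0\<close>.  Hence the closed
  span, seen inside \<open>\<Oplus>n\<le>-m. L\<^sub>n\<close>, has trivial orthogonal complement there.
\<close>

lemma star_canonical_m1_T: "star_canonical_m1 m T = subsum {..- int m}"
proof -
  define G where "G = {(Ts ^^ k) h | k h. h \<in> subsum {0} \<and> m \<le> k}"
  have G: "G = {incl (- int k) (D x, 0) | k x. m \<le> k}"
  proof -
    have "(Ts ^^ k) h = incl (- int k) (D (fst (entry h 0)), 0)" if "h \<in> subsum {0}" "m \<le> k" for k h
      using Ts_power_incl[of k "fst (entry h 0)"] that(2) unfolding L0_incl(2)[OF that(1)] by simp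
    moreover have "incl (- int k) (D x, 0) = (Ts ^^ k) (incl 0 (x, 0))"
        "incl 0 (x, 0) \<in> subsum {0}" if "m \<le> k" for k x
      using that by (auto simp: Ts_power_incl intro: incl_in_subsum summand_nonpos)
    ultimately show ?thesis
      unfolding G_def by blast
  qed
  define K where "K = closure (cspan G)"
  have cspan_subspace: "subspace (cspan G)"
    by (simp add: subspace_def complex_vector.span_zero complex_vector.span_add
        complex_vector.span_scale scaleR_scaleC)
  have K: "subspace K" "closed K"
    unfolding K_def using subspace_closure[OF cspan_subspace] by auto
  have Z: "csubspace (subsum {..- int m} :: ('m, 'n) bisum set)"
    "closed (subsum {..- int m} :: ('m, 'n) bisum set)"
    using closed_csubspace_subsum by (auto simp: closed_csubspace_def)
  have "G \<subseteq> subsum {..- int m}"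
    unfolding G by (auto intro!: incl_in_subsum summand_nonpos)
  then have K_sub: "K \<subseteq> subsum {..- int m}"
    unfolding K_def using Z by (intro closure_minimal complex_vector.span_minimal)
  have "h \<in> K" if h: "h \<in> subsum {..- int m}" for h
  proof -
    obtain k where k: "k \<in> K" and orth: "\<And>y. y \<in> K \<Longrightarrow> inner (h - k) y = 0"
      using orthogonal_projection_exists[OF K] by blast
    have hk: "h - k \<in> subsum {..- int m}"
      using h k K_sub Z(1) complex_vector.subspace_diff by blast
    have "h - k = 0"
    proof (rule bisum_eqI)
      fix n
      show "entry (h - k) n = entry 0 n"
      proof (cases "n \<le> - int m")
        case True
        define j where "j = nat (- n)"
        have j: "n = - int j" "m \<le> j"
          using True by (auto simp: j_def)
        have "cinner x (D (fst (entry (h - k) n))) = cinner x 0" for x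
        proof -
          let ?u = "incl n (D x, 0) :: ('m, 'n) bisum"
          have "?u \<in> G"
            unfolding G using j by blast
          \<comment> \<open>Both \<open>u\<close> and \<open>\<i> u\<close> are needed to turn real orthogonality into complex orthogonality.\<close>
          then have "?u \<in> cspan G" "\<i> *\<^sub>C ?u \<in> cspan G"
            by (auto intro: complex_vector.span_base complex_vector.span_scale)
          then have "?u \<in> K" "\<i> *\<^sub>C ?u \<in> K"
            unfolding K_def using closure_subset by blast+
          then have "cinner ?u (h - k) = 0"
            using orth by (intro cinner_eq_zero_if_inner) (auto simp: inner_commute[of _ "h - k"])
          moreover have "n \<le> 0"
            using True by simp
          ultimately show ?thesis
            by (simp add: cinner_incl[OF summand_nonpos] cinner_prod_def is_adjointD[OF D_adjoint])
        qed
        then have "D (fst (entry (h - k) n)) = 0"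
          by (rule cinner_nondegenerate)
        then have "fst (entry (h - k) n) = 0"
          by (rule D_injective)
        then show ?thesis
          using True by (simp add: prod_eq_iff snd_entry entry_zero)
      next
        case False
        then show ?thesis
          using hk by (simp add: subsum_def entry_zero)
      qed
    qed
    then show ?thesis
      using k by simp
  qed
  then have "K = subsum {..- int m}"
    using K_sub by blast
  then show ?thesis
    unfolding star_canonical_m1_def cadjoint_T defect_space_T K_def G_def .
qed

lemma star_canonical_0_T: "star_canonical_0 m T = subsum {- int m + 1..0}"
proof -
  have "- ({1..} \<union> {..- int m}) = {- int m + 1..0}"
    by auto
  then show ?thesis
    by (simp only: star_canonical_0_def star_canonical_1_T star_canonical_m1_T orth_compl_subsum)
qed

text \<open>
  Block triangularity only needs that the forward shift does not lower indices: the two exceptional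
  images of \<open>L\<^bsub>-m\<^esub>\<close> land in the first two spaces, and \<open>L\<^bsub>-m\<^esub>\<close> itself belongs to the third.
\<close>

lemma upper_triangular_T:
  "upper_triangular_wrt T (subsum {1..}) (subsum {- int m + 1..0}) (subsum {..- int m})"
  unfolding upper_triangular_wrt_def
proof (intro conjI)
  show "orth_decomposition (subsum {1..} :: ('m, 'n) bisum set) (subsum {- int m + 1..0})
      (subsum {..- int m})"
    by (rule orth_decomposition_subsum) auto
  have X: "T ` subsum {1..} \<subseteq> subsum {1..}"
    using T_shift[of _ 1] by (fastforce simp: subsum_def)
  have Y: "T ` subsum {- int m + 1..0} \<subseteq> subsum {- int m + 1..}"
    by (auto simp: subsum_def entry_T)
  show "T ` subsum {1..} \<subseteq> orth_compl (subsum {- int m + 1..0})"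
    "T ` subsum {1..} \<subseteq> orth_compl (subsum {..- int m})"
    by (rule order_trans[OF X subsum_orthogonal]; auto)+
  show "T ` subsum {- int m + 1..0} \<subseteq> orth_compl (subsum {..- int m})"
    by (rule order_trans[OF Y subsum_orthogonal]) auto
qed

end

theorem theorem7p4:
  fixes A :: "'m::chilbert_space \<Rightarrow> 'n::chilbert_space" and m :: nat
  assumes "m \<ge> 1"
    and "separable_space (euclidean :: 'm topology)"
    and "separable_space (euclidean :: 'n topology)"
    and "pure_contraction A"
    and "A \<noteq> (\<lambda>_. 0)"
  shows "cnu_contraction (model_op m A) \<and>
    partial_isometry (model_op m A) \<and>
    coincide
      (defect_space (model_op m A)) (defect_space (cadjoint (model_op m A)))
      (char_fun (model_op m A))
      (UNIV :: 'm set) (UNIV :: 'n set) (\<lambda>z h. z ^ m *\<^sub>C A h) \<and>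
    star_canonical_representation (model_op m A)
      (subsum {1..}) (subsum {- int m + 1..0}) (subsum {..- int m})"
proof -
  interpret pure_model m A
    by unfold_locales (rule assms)+
  have "star_canonical_representation T (subsum {1..}) (subsum {- int m + 1..0}) (subsum {..- int m})"
    unfolding star_canonical_representation_def
    using T_cnu upper_triangular_T char_fun_polynomial[OF assms(5)]
      star_canonical_1_T star_canonical_0_T star_canonical_m1_T by metis
  then show ?thesis
    using T_cnu T_partial_isometry char_fun_coincides by blast
qed

end
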